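(* Let $\alpha\in\mathbb{R}\setminus\mathbb{Q}$, let $Tx=x+\alpha$ on $\mathbb{T}=\mathbb{R}/\mathbb{Z}$, and let $f:\mathbb{T}\to\mathbb{R}$ be a continuous positive function. If there exists $s\in I_{top}(T^f)\setminus\{-1,1\}$, then $f$ is cohomologous to a constant function via a continuous transfer function, i.e. there exist a constant $c\in\mathbb{R}$ and a continuous $h:\mathbb{T}\to\mathbb{R}$ such that $f(x)-c=h(x)-h(x+\alpha)$ for all $x\in\mathbb{T}$.
   Context: Topological special flow: $X^f$ is the quotient of $\mathbb{T}\times\mathbb{R}$ by the orbit relation of the homeomorphism $T_{-f}(x,r)=(Tx,r-f(x))$; the flow $\sigma_t(x,r)=(x,r+t)$ commutes with $T_{-f}$ and hence induces a continuous flow $T^f=(T^f_t)_{t\in\mathbb{R}}$ on the compact space $X^f$. For a continuous flow $\mathcal{T}=(T_t)_{t\in\mathbb{R}}$ on a compact metric space, $I_{top}(\mathcal{T})$ is the group of $s\in\mathbb{R}^*=\mathbb{R}\setminus\{0\}$ such that $\mathcal{T}$ and $\mathcal{T}\circ s=(T_{st})_{t\in\mathbb{R}}$ are topologically conjugate. *)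

theory Defs
  imports "HOL-Analysis.Analysis"
begin

section \<open>The circle \<open>\<real>/\<int>\<close>\<close>

quotient_type circle = real / "\<lambda>x y. x - y \<in> \<int>"
  morphisms rep_circle to_circle
proof (rule equivpI)
  show "reflp (\<lambda>x y::real. x - y \<in> \<int>)"
    by (simp add: reflp_def)
  show "symp (\<lambda>x y::real. x - y \<in> \<int>)"
  proof (rule sympI)
    fix x y :: real assume "x - y \<in> \<int>"
    then have "- (x - y) \<in> \<int>" by (rule Ints_minus)
    then show "y - x \<in> \<int>" by simp
  qed
  show "transp (\<lambda>x y::real. x - y \<in> \<int>)"
  proof (rule transpI)
    fix x y z :: real assume "x - y \<in> \<int>" "y - z \<in> \<int>"
    then have "(x - y) + (y - z) \<in> \<int>" by (rule Ints_add)
    then show "x - z \<in> \<int>" by simp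
  qed
qed

instantiation circle :: ab_group_add
begin

lift_definition zero_circle :: circle is "0::real" .

lift_definition plus_circle :: "circle \<Rightarrow> circle \<Rightarrow> circle" is "(+) :: real \<Rightarrow> real \<Rightarrow> real"
proof -
  fix a b c d :: real assume "a - b \<in> \<int>" "c - d \<in> \<int>"
  then have "(a - b) + (c - d) \<in> \<int>" by (rule Ints_add)
  then show "a + c - (b + d) \<in> \<int>" by (simp add: algebra_simps)
qed

lift_definition uminus_circle :: "circle \<Rightarrow> circle" is "uminus :: real \<Rightarrow> real"
proof -
  fix a b :: real assume "a - b \<in> \<int>"
  then have "- (a - b) \<in> \<int>" by (rule Ints_minus)
  then show "- a - - b \<in> \<int>" by simp
qed

lift_definition minus_circle :: "circle \<Rightarrow> circle \<Rightarrow> circle" is "(-) :: real \<Rightarrow> real \<Rightarrow> real"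
proof -
  fix a b c d :: real assume "a - b \<in> \<int>" "c - d \<in> \<int>"
  then have "(a - b) - (c - d) \<in> \<int>" by (rule Ints_diff)
  then show "a - c - (b - d) \<in> \<int>" by (simp add: algebra_simps)
qed

instance
  by standard (transfer, simp add: algebra_simps)+

end

instantiation circle :: topological_space
begin

definition open_circle :: "circle set \<Rightarrow> bool"
  where "open_circle U \<longleftrightarrow> open (to_circle -` U)"

instance
proof
  show "open (UNIV :: circle set)"
    by (simp add: open_circle_def)
  show "open (S \<inter> T)" if "open S" "open T" for S T :: "circle set"
    using that by (simp add: open_circle_def open_Int)
  show "open (\<Union>K)" if "\<forall>S\<in>K. open S" for K :: "circle set set"
    using that by (auto simp: open_circle_def vimage_Union)
qed

end

section \<open>Topological conjugacy of flows\<close>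

definition topologically_conjugate ::
    "'a topology \<Rightarrow> (real \<Rightarrow> 'a \<Rightarrow> 'a) \<Rightarrow> 'b topology \<Rightarrow> (real \<Rightarrow> 'b \<Rightarrow> 'b) \<Rightarrow> bool"
  where "topologically_conjugate X S Y T \<longleftrightarrow>
    (\<exists>H. homeomorphic_map X Y H \<and> (\<forall>t. \<forall>x\<in>topspace X. H (S t x) = T t (H x)))"

definition I_top :: "'a topology \<Rightarrow> (real \<Rightarrow> 'a \<Rightarrow> 'a) \<Rightarrow> real set"
  where "I_top X T = {s. s \<noteq> 0 \<and> topologically_conjugate X T X (\<lambda>t. T (s * t))}"

section \<open>Topological special flows over rotations\<close>

text \<open>For a bijection \<open>F\<close> this is the relation of lying on the same two-sided \<open>F\<close>-orbit.\<close>

definition orbit_rel :: "('a \<Rightarrow> 'a) \<Rightarrow> ('a \<times> 'a) set"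
  where "orbit_rel F = {(p, q). \<exists>n::nat. q = (F ^^ n) p \<or> p = (F ^^ n) q}"

text \<open>The points of the quotient space are the equivalence classes of \<open>r\<close>; a set of classes
  is open iff its preimage under the projection, i.e. its union, is open.\<close>

definition quotient_topology :: "('a::topological_space \<times> 'a) set \<Rightarrow> 'a set topology"
  where "quotient_topology r = topology (\<lambda>U. U \<subseteq> UNIV // r \<and> open (\<Union>U))"

lemma openin_quotient_topology:
  assumes "equiv UNIV r"
  shows "openin (quotient_topology r) U \<longleftrightarrow> U \<subseteq> UNIV // r \<and> open (\<Union>U)"
proof -
  have Int: "\<Union>(S \<inter> T) = \<Union>S \<inter> \<Union>T" if "S \<subseteq> UNIV // r" "T \<subseteq> UNIV // r" for S T
  proof
    show "\<Union>S \<inter> \<Union>T \<subseteq> \<Union>(S \<inter> T)"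
    proof
      fix x assume "x \<in> \<Union>S \<inter> \<Union>T"
      then obtain A B where AB: "A \<in> S" "B \<in> T" "x \<in> A" "x \<in> B" by blast
      then have "A = B"
        using quotient_disj[OF assms, of A B] that by blast
      with AB show "x \<in> \<Union>(S \<inter> T)" by blast
    qed
  qed blast
  have "istopology (\<lambda>U. U \<subseteq> UNIV // r \<and> open (\<Union>U))"
    unfolding istopology_def
  proof (intro conjI allI impI)
    fix S T assume "S \<subseteq> UNIV // r \<and> open (\<Union>S)" "T \<subseteq> UNIV // r \<and> open (\<Union>T)"
    then show "S \<inter> T \<subseteq> UNIV // r" "open (\<Union>(S \<inter> T))"
      by (auto simp: Int)
  next
    fix K assume K: "\<forall>U\<in>K. U \<subseteq> UNIV // r \<and> open (\<Union>U)"
    then show "\<Union>K \<subseteq> UNIV // r" by blast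
    have "\<Union>(\<Union>K) = (\<Union>U\<in>K. \<Union>U)" by blast
    with K show "open (\<Union>(\<Union>K))" by (metis open_UN)
  qed
  then show ?thesis
    by (simp add: quotient_topology_def topology_inverse')
qed

lemma topspace_quotient_topology:
  assumes "equiv UNIV r"
  shows "topspace (quotient_topology r) = UNIV // r"
proof -
  have "openin (quotient_topology r) (UNIV // r)"
    using assms by (simp add: openin_quotient_topology Union_quotient)
  then show ?thesis
    by (meson assms openin_quotient_topology openin_subset openin_topspace subset_antisym)
qed

definition skew :: "real \<Rightarrow> (circle \<Rightarrow> real) \<Rightarrow> circle \<times> real \<Rightarrow> circle \<times> real"
  where "skew \<alpha> f = (\<lambda>(x, r). (x + to_circle \<alpha>, r - f x))"

definition special_flow_space :: "real \<Rightarrow> (circle \<Rightarrow> real) \<Rightarrow> (circle \<times> real) set topology"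
  where "special_flow_space \<alpha> f = quotient_topology (orbit_rel (skew \<alpha> f))"

text \<open>The vertical translation commutes with \<^term>\<open>skew \<alpha> f\<close>, so its image of an orbit is again
  an orbit; taking images of classes is the induced map on the quotient.\<close>

definition special_flow :: "real \<Rightarrow> (circle \<times> real) set \<Rightarrow> (circle \<times> real) set"
  where "special_flow t c = (\<lambda>(x, r). (x, r + t)) ` c"

lemma bij_skew: "bij (skew \<alpha> f)"
proof (rule bij_betw_byWitness)
  let ?g = "\<lambda>(x, r). (x - to_circle \<alpha>, r + f (x - to_circle \<alpha>))"
  show "\<forall>p\<in>UNIV. ?g (skew \<alpha> f p) = p" "\<forall>p\<in>UNIV. skew \<alpha> f (?g p) = p"
    by (simp_all add: skew_def)
qed simp_all

lemma equiv_orbit_rel: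
  assumes "bij F"
  shows "equiv UNIV (orbit_rel F)"
proof (rule equivI)
  show "orbit_rel F \<subseteq> UNIV \<times> UNIV" by simp
  show "refl (orbit_rel F)"
    by (auto simp: refl_on_def orbit_rel_def intro: exI[of _ 0])
  show "sym (orbit_rel F)"
    by (auto simp: sym_def orbit_rel_def)
  have inj: "inj (F ^^ n)" for n
    using assms bij_is_inj inj_fn by blast
  have cmp: "(F ^^ n) p = (F ^^ m) q \<Longrightarrow> (p, q) \<in> orbit_rel F" for n m p q
  proof (cases "n \<le> m")
    case True
    assume "(F ^^ n) p = (F ^^ m) q"
    then have "(F ^^ n) p = (F ^^ n) ((F ^^ (m - n)) q)"
      using True fun_cong[OF funpow_add, of n "m - n" F q] by simp
    then show ?thesis using inj[of n] by (auto simp: orbit_rel_def inj_eq)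
  next
    case False
    assume "(F ^^ n) p = (F ^^ m) q"
    then have "(F ^^ m) ((F ^^ (n - m)) p) = (F ^^ m) q"
      using False fun_cong[OF funpow_add, of m "n - m" F p] by simp
    then show ?thesis using inj[of m] by (auto simp: orbit_rel_def inj_eq)
  qed
  have ex: "\<exists>n m. (F ^^ n) p = (F ^^ m) q" if pq: "(p, q) \<in> orbit_rel F" for p q
  proof -
    obtain n where "(F ^^ 0) q = (F ^^ n) p \<or> (F ^^ 0) p = (F ^^ n) q"
      using pq by (auto simp: orbit_rel_def)
    then show ?thesis by metis
  qed
  show "trans (orbit_rel F)"
  proof (rule transI)
    fix p q r assume "(p, q) \<in> orbit_rel F" "(q, r) \<in> orbit_rel F"
    then obtain a b c d where "(F ^^ a) p = (F ^^ b) q" "(F ^^ c) q = (F ^^ d) r"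
      using ex by meson
    then have "(F ^^ c) ((F ^^ a) p) = (F ^^ b) ((F ^^ d) r)"
      using fun_cong[OF funpow_add, of c b F q] fun_cong[OF funpow_add, of b c F q]
      by (simp add: add.commute)
    then have "(F ^^ (c + a)) p = (F ^^ (b + d)) r"
      by (simp add: funpow_add)
    then show "(p, r) \<in> orbit_rel F" by (rule cmp)
  qed
qed

lemma special_flow_class:
  "special_flow t (orbit_rel (skew \<alpha> f) `` {(x, r)}) = orbit_rel (skew \<alpha> f) `` {(x, r + t)}"
proof -
  define s where "s = (\<lambda>t (x, r). (x, r + t) :: circle \<times> real)"
  have comm: "(skew \<alpha> f ^^ n) (s t p) = s t ((skew \<alpha> f ^^ n) p)" for n t p
  proof (induction n)
    case (Suc n)
    have "skew \<alpha> f (s t q) = s t (skew \<alpha> f q)" for q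
      by (cases q) (simp add: skew_def s_def)
    with Suc show ?case by simp
  qed simp
  have inj: "s t p = s t q \<longleftrightarrow> p = q" for t p q
    by (cases p; cases q) (simp add: s_def)
  have *: "(s t p, s t q) \<in> orbit_rel (skew \<alpha> f) \<longleftrightarrow> (p, q) \<in> orbit_rel (skew \<alpha> f)" for p q
    by (simp add: orbit_rel_def comm inj)
  have "s t ` (orbit_rel (skew \<alpha> f) `` {p}) = orbit_rel (skew \<alpha> f) `` {s t p}" for p
  proof (intro equalityI subsetI)
    fix q assume "q \<in> s t ` (orbit_rel (skew \<alpha> f) `` {p})"
    then obtain q' where "q = s t q'" "(p, q') \<in> orbit_rel (skew \<alpha> f)" by blast
    then show "q \<in> orbit_rel (skew \<alpha> f) `` {s t p}" by (simp add: *)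
  next
    fix q assume q: "q \<in> orbit_rel (skew \<alpha> f) `` {s t p}"
    have q': "q = s t (s (- t) q)" by (cases q) (simp add: s_def)
    then have "(s t p, s t (s (- t) q)) \<in> orbit_rel (skew \<alpha> f)" using q by simp
    then have "s (- t) q \<in> orbit_rel (skew \<alpha> f) `` {p}" by (simp only: *) simp
    with q' show "q \<in> s t ` (orbit_rel (skew \<alpha> f) `` {p})" by (rule image_eqI)
  qed
  from this[of "(x, r)"] show ?thesis
    by (simp add: special_flow_def s_def)
qed

end

theory Submission
  imports Defs
begin

text \<open>
  The plane covers the phase space of the special flow, the deck group being \<open>\<int>\<^sup>2\<close> acting through the
  translations by \<open>\<int> + \<alpha>\<int>\<close> and the Birkhoff cocycle of the roof function. A conjugacy between the
  flow and its rescaling by \<open>s\<close> lifts to a map \<open>(x, r) \<mapsto> (\<phi> x, s r + g x)\<close>; equivariance and density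
  of \<open>\<int> + \<alpha>\<int>\<close> force \<open>\<phi> x = \<mu> x + c\<close>. Hence multiplication by \<open>\<mu>\<close> preserves \<open>\<int> + \<alpha>\<int>\<close> and carries the
  cocycle to \<open>s\<close> times itself up to the coboundary of \<open>g\<close>. If \<open>\<bar>\<mu>\<bar> = 1\<close>, then \<open>g\<close> is bounded and comparing
  Birkhoff sums gives \<open>\<bar>s\<bar> = 1\<close>. Otherwise, passing to the inverse, \<open>\<bar>\<mu>\<bar> < 1\<close>, and discreteness of the deck
  group gives \<open>\<bar>s\<bar> > 1\<close>. Solving \<open>u (\<mu> x + c) = s u x + g x\<close> by a geometric series turns the
  relation into an exact one, \<open>s V\<^sub>\<theta>(x) = V\<^bsub>\<mu>\<theta>\<^esub>(\<mu> x + c)\<close>, for the cocycle \<open>V\<close> corrected by \<open>u\<close>. Iterating,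
  the oscillation of \<open>V\<^sub>\<theta>\<close> is \<open>s\<^bsup>-k\<^esup>\<close> times that of a sum of \<open>O(s\<^bsup>k\<^esup>)\<close> terms at exponentially close points,
  so it vanishes by uniform continuity of the roof. That \<open>V\<^sub>1\<close> and \<open>V\<^sub>\<alpha>\<close> are constant is the claim.
\<close>

section \<open>Functions on the line\<close>

lemma periodic_add_int:
  fixes q :: "real \<Rightarrow> 'a"
  assumes "\<And>x. q (x + 1) = q x"
  shows "q (x + of_int i) = q x"
proof (induction i rule: int_induct[where k = 0])
  case (step1 i)
  then show ?case using assms[of "x + of_int i"] by (simp add: add.assoc)
next
  case (step2 i)
  then show ?case using assms[of "x + of_int (i - 1)"] by (simp add: add.assoc)
qed simp

lemma continuous_periodic_bounded:
  fixes q :: "real \<Rightarrow> real"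
  assumes "continuous_on UNIV q" "\<And>x. q (x + 1) = q x"
  obtains C where "C > 0" "\<And>x. \<bar>q x\<bar> \<le> C"
proof -
  have "compact (q ` {0..1})"
    using assms(1) by (intro compact_continuous_image) (auto intro: continuous_on_subset)
  then obtain C where C: "C > 0" "\<forall>y\<in>q ` {0..1}. norm y \<le> C"
    using compact_imp_bounded bounded_pos by blast
  have "\<bar>q x\<bar> \<le> C" for x
  proof -
    have "q x = q (frac x)"
      using periodic_add_int[of q, OF assms(2), of "frac x" "\<lfloor>x\<rfloor>"] by (simp add: frac_def)
    moreover have "frac x \<in> {0..1}"
      using frac_lt_1[of x] by simp
    ultimately show ?thesis
      using C(2) by auto
  qed
  with C(1) show ?thesis by (rule that)
qed

lemma continuous_periodic_uniform:
  fixes q :: "real \<Rightarrow> real"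
  assumes "continuous_on UNIV q" "\<And>x. q (x + 1) = q x"
  shows "uniformly_continuous_on UNIV q"
  unfolding uniformly_continuous_on_def
proof (intro allI impI)
  fix e :: real assume "e > 0"
  \<comment> \<open>Translating by \<open>\<lfloor>x\<rfloor>\<close> puts \<open>x\<close> into
    \<open>{0..1}\<close>; the margin of one on each side keeps the nearby \<open>y\<close> inside
    the compact interval.\<close>
  have "uniformly_continuous_on {-1..2} q"
    using assms(1) by (intro compact_uniformly_continuous) (auto intro: continuous_on_subset)
  then obtain d where d: "d > 0"
      "\<And>x y. x \<in> {-1..2} \<Longrightarrow> y \<in> {-1..2} \<Longrightarrow> dist y x < d \<Longrightarrow> dist (q y) (q x) < e"
    using \<open>e > 0\<close> unfolding uniformly_continuous_on_def by metis
  have "dist (q y) (q x) < e" if "dist y x < min d 1" for x y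
  proof -
    define n where "n = \<lfloor>x\<rfloor>"
    have "x - of_int n \<in> {0..1}"
      unfolding n_def using floor_correct[of x] by (auto simp: algebra_simps)
    then have "x - of_int n \<in> {-1..2}" "y - of_int n \<in> {-1..2}" "dist (y - of_int n) (x - of_int n) < d"
      using that by (auto simp: dist_real_def)
    then have "dist (q (y - of_int n)) (q (x - of_int n)) < e"
      by (intro d(2))
    then show ?thesis
      using periodic_add_int[of q, OF assms(2), of "y - of_int n" n]
        periodic_add_int[of q, OF assms(2), of "x - of_int n" n] by simp
  qed
  with d(1) show "\<exists>d>0. \<forall>x\<in>UNIV. \<forall>x'\<in>UNIV. dist x' x < d \<longrightarrow> dist (q x') (q x) < e"
    by (intro exI[of _ "min d 1"]) auto
qed

text \<open>The radius \<open>\<rho> = \<bar>c\<bar> / (1 - \<bar>\<mu>\<bar>)\<close> solves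
  \<open>\<bar>\<mu>\<bar> * \<rho> + \<bar>c\<bar> = \<rho>\<close> and the part \<open>R\<close>
  only shrinks, so one bound serves every \<open>k\<close>.\<close>

lemma contraction_orbit_bounded:
  fixes \<mu> c :: real
  assumes "\<bar>\<mu>\<bar> < 1" "\<bar>x\<bar> \<le> R"
  shows "\<bar>((\<lambda>x. \<mu> * x + c) ^^ k) x\<bar> \<le> R + \<bar>c\<bar> / (1 - \<bar>\<mu>\<bar>)"
proof (induction k)
  case 0
  then show ?case using assms by (simp add: add_increasing2)
next
  case (Suc k)
  let ?z = "((\<lambda>x. \<mu> * x + c) ^^ k) x"
  have R: "R \<ge> 0" using assms(2) by linarith
  have "\<bar>\<mu> * ?z + c\<bar> \<le> \<bar>\<mu>\<bar> * \<bar>?z\<bar> + \<bar>c\<bar>"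
    by (metis abs_mult abs_triangle_ineq)
  also have "\<dots> \<le> \<bar>\<mu>\<bar> * (R + \<bar>c\<bar> / (1 - \<bar>\<mu>\<bar>)) + \<bar>c\<bar>"
    using Suc by (intro add_mono mult_left_mono) auto
  also have "\<dots> = \<bar>\<mu>\<bar> * R + \<bar>c\<bar> / (1 - \<bar>\<mu>\<bar>)"
    using assms(1) by (simp add: field_simps)
  also have "\<dots> \<le> R + \<bar>c\<bar> / (1 - \<bar>\<mu>\<bar>)"
    using assms(1) R by (simp add: mult_left_le_one_le)
  finally show ?case by simp
qed

lemma contraction_orbit_shift:
  fixes \<mu> c :: real
  shows "((\<lambda>x. \<mu> * x + c) ^^ k) (x + \<theta>) = ((\<lambda>x. \<mu> * x + c) ^^ k) x + \<mu> ^ k * \<theta>"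
  by (induction k) (auto simp: algebra_simps)

lemma continuous_bounded_interval:
  fixes g :: "real \<Rightarrow> real"
  assumes "continuous_on UNIV g"
  obtains C where "C > 0" "\<And>x. \<bar>x\<bar> \<le> R \<Longrightarrow> \<bar>g x\<bar> \<le> C"
proof -
  have "compact (g ` {-R..R})"
    using assms by (intro compact_continuous_image) (auto intro: continuous_on_subset)
  then obtain C where "C > 0" "\<forall>y\<in>g ` {-R..R}. norm y \<le> C"
    using compact_imp_bounded bounded_pos by blast
  then show ?thesis
    by (intro that[of C]) (auto simp: abs_le_iff)
qed

lemma additive_bounded_imp_zero:
  fixes p :: "real \<Rightarrow> real"
  assumes add: "\<And>x y. p (x + y) = p x + p y" and bound: "\<And>x. \<bar>p x\<bar> \<le> C"
  shows "p x = 0"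
proof (rule ccontr)
  assume "p x \<noteq> 0"
  have p0: "p 0 = 0" using add[of 0 0] by simp
  have mult: "p (real n * x) = real n * p x" for n
    by (induction n) (auto simp: p0 add algebra_simps)
  obtain n :: nat where "C < real n * \<bar>p x\<bar>"
    using reals_Archimedean3[of "\<bar>p x\<bar>"] \<open>p x \<noteq> 0\<close> by auto
  then show False
    using bound[of "real n * x"] by (simp add: mult abs_mult)
qed

text \<open>Subtracting \<open>\<psi> 1 * x\<close> leaves an additive map that vanishes at 1, hence
  is 1-periodic, hence bounded; only zero is additive and bounded.\<close>

lemma continuous_additive_imp_linear:
  fixes \<psi> :: "real \<Rightarrow> real"
  assumes cont: "continuous_on UNIV \<psi>" and add: "\<And>x y. \<psi> (x + y) = \<psi> x + \<psi> y"
  shows "\<psi> x = \<psi> 1 * x"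
proof -
  let ?p = "\<lambda>x. \<psi> x - \<psi> 1 * x"
  obtain C where "\<And>x. \<bar>?p x\<bar> \<le> C"
    by (rule continuous_periodic_bounded[of ?p])
       (auto intro!: continuous_intros cont simp: add algebra_simps)
  then have "?p x = 0"
    by (intro additive_bounded_imp_zero[of ?p]) (auto simp: add algebra_simps)
  then show ?thesis by simp
qed

text \<open>Iterating \<open>u x = (u (l x) - g x) / s\<close> with
  \<open>l x = \<mu> * x + c\<close> suggests minus the sum of
  \<open>g ((l ^^ k) x) / s ^ Suc k\<close>. Orbits stay bounded, so a geometric series dominates it
  uniformly on bounded sets.\<close>

lemma contracting_series:
  fixes g :: "real \<Rightarrow> real"
  assumes g: "continuous_on UNIV g" and \<mu>: "\<bar>\<mu>\<bar> < 1" and s: "\<bar>s\<bar> > 1"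
  obtains u where "continuous_on UNIV u" "\<And>x. u (\<mu> * x + c) = s * u x + g x"
proof -
  define l where "l = (\<lambda>x. \<mu> * x + c)"
  define a where "a = (\<lambda>k x. g ((l ^^ k) x) / s ^ Suc k)"
  have l_cont: "continuous_on UNIV (l ^^ k)" for k
    by (induction k) (auto simp: l_def intro!: continuous_intros)
  have a_cont: "continuous_on A (a k)" for k A
    unfolding a_def
    by (intro continuous_intros continuous_on_compose2[OF g] continuous_on_subset[OF l_cont])
       (use s in auto)
  have bound: "\<exists>C. \<forall>x k. \<bar>x\<bar> \<le> R \<longrightarrow> \<bar>a k x\<bar> \<le> C * (1 / \<bar>s\<bar>) ^ Suc k" for R
  proof -
    obtain C where C: "\<And>x. \<bar>x\<bar> \<le> R + \<bar>c\<bar> / (1 - \<bar>\<mu>\<bar>) \<Longrightarrow> \<bar>g x\<bar> \<le> C"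
      using continuous_bounded_interval[OF g] by blast
    have "\<bar>a k x\<bar> \<le> C * (1 / \<bar>s\<bar>) ^ Suc k" if "\<bar>x\<bar> \<le> R" for k x
    proof -
      have "\<bar>g ((l ^^ k) x)\<bar> \<le> C"
        unfolding l_def by (intro C contraction_orbit_bounded \<mu> that)
      then show ?thesis
        unfolding a_def abs_divide power_abs power_divide by (simp add: divide_right_mono abs_mult power_abs)
    qed
    then show ?thesis by blast
  qed
  have geo: "summable (\<lambda>k. C * (1 / \<bar>s\<bar>) ^ Suc k)" for C :: real
    using s by (intro summable_mult) (simp only: summable_Suc_iff, simp)
  have summ: "summable (\<lambda>k. a k x)" for x
  proof -
    obtain C where "\<forall>k. \<bar>a k x\<bar> \<le> C * (1 / \<bar>s\<bar>) ^ Suc k"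
      using bound[of "\<bar>x\<bar>"] by blast
    then show ?thesis
      by (intro summable_comparison_test[OF _ geo[of C]]) auto
  qed
  define u where "u = (\<lambda>x. - (\<Sum>k. a k x))"
  have "isCont u x" for x
  proof -
    obtain C where C: "\<And>y k. \<bar>y\<bar> \<le> \<bar>x\<bar> + 1 \<Longrightarrow> \<bar>a k y\<bar> \<le> C * (1 / \<bar>s\<bar>) ^ Suc k"
      using bound[of "\<bar>x\<bar> + 1"] by blast
    have "uniform_limit (ball x 1) (\<lambda>n y. \<Sum>k<n. a k y) (\<lambda>y. \<Sum>k. a k y) sequentially"
      by (rule Weierstrass_m_test[OF _ geo[of C]]) (simp only: real_norm_def, intro C, auto simp: dist_real_def)
    then have "continuous_on (ball x 1) (\<lambda>y. \<Sum>k. a k y)"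
      by (rule uniform_limit_theorem[rotated]) (auto intro!: always_eventually continuous_on_sum a_cont)
    then show ?thesis
      unfolding u_def
      by (intro continuous_intros) (simp add: continuous_on_eq_continuous_at)
  qed
  then have "continuous_on UNIV u"
    by (simp add: continuous_on_eq_continuous_at)
  moreover have "u (\<mu> * x + c) = s * u x + g x" for x
  proof -
    \<comment> \<open>The series at \<open>l x\<close> is \<open>s\<close> times the shifted series;
      the missing head \<open>a 0 x\<close> produces the term \<open>g x\<close>.\<close>
    have *: "a k (l x) = s * a (Suc k) x" for k
      using s by (auto simp: a_def funpow_swap1 field_simps)
    have "(\<Sum>k. a k (l x)) = s * (\<Sum>k. a (Suc k) x)"
      unfolding * by (rule suminf_mult) (use summ[of x] summable_Suc_iff[of "\<lambda>k. a k x"] in simp)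
    also have "(\<Sum>k. a (Suc k) x) = (\<Sum>k. a k x) - a 0 x"
      by (rule suminf_split_head) (rule summ)
    also have "s * \<dots> = s * (\<Sum>k. a k x) - g x"
      using s by (auto simp: a_def field_simps)
    finally show ?thesis by (simp add: u_def l_def)
  qed
  ultimately show ?thesis by (rule that)
qed

section \<open>The Birkhoff cocycle over an irrational rotation\<close>

locale irrational_roof =
  fixes \<alpha> :: real and F :: "real \<Rightarrow> real"
  assumes irrational: "\<alpha> \<notin> \<rat>"
    and continuous_F: "continuous_on UNIV F"
    and periodic_F: "\<And>x. F (x + 1) = F x"
    and positive_F: "\<And>x. F x > 0"
begin

definition G :: "real set"
  where "G = {of_int i + of_int j * \<alpha> |i j. True}"

text \<open>Irrationality makes the coefficient of \<alpha> unique on \<open>G\<close>; elsewhere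
  the value is unspecified.\<close>

definition J :: "real \<Rightarrow> int"
  where "J \<theta> = (THE j. \<exists>i. \<theta> = of_int i + of_int j * \<alpha>)"

text \<open>For \<open>j < 0\<close> this is minus the sum of \<open>F\<close> over the \<open>-j\<close> preceding
  points of the orbit.\<close>

definition S :: "int \<Rightarrow> real \<Rightarrow> real"
  where "S j x = (\<Sum>i\<in>{0..<j}. F (x + of_int i * \<alpha>)) - (\<Sum>i\<in>{j..<0}. F (x + of_int i * \<alpha>))"

text \<open>The Birkhoff cocycle extended to all translations by \<open>G\<close>: the integer part
  of \<theta> contributes nothing because \<open>F\<close> is 1-periodic.\<close>

definition B :: "real \<Rightarrow> real \<Rightarrow> real"
  where "B \<theta> = S (J \<theta>)"

section \<open>Coordinates and density of the translation group \<open>G\<close>\<close>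

lemma G_I [intro, simp]: "of_int i + of_int j * \<alpha> \<in> G"
  unfolding G_def by blast

lemma G_unique:
  assumes "of_int i + of_int j * \<alpha> = of_int i' + of_int j' * \<alpha>"
  shows "i = i'" "j = j'"
proof -
  show j: "j = j'"
  proof (rule ccontr)
    assume "j \<noteq> j'"
    then have "\<alpha> = of_int (i' - i) / of_int (j - j')"
      using assms by (simp add: field_simps)
    then have "\<alpha> \<in> \<rat>"
      by (metis Rats_divide Rats_of_int)
    with irrational show False ..
  qed
  show "i = i'"
    using assms j by simp
qed

lemma J_eq [simp]: "J (of_int i + of_int j * \<alpha>) = j"
  unfolding J_def by (rule the_equality) (use G_unique in blast)+

lemma G_cases:
  assumes "\<theta> \<in> G"
  obtains i where "\<theta> = of_int i + of_int (J \<theta>) * \<alpha>"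
  using assms J_eq unfolding G_def by fastforce

lemma G_1 [simp]: "1 \<in> G" and J_1 [simp]: "J 1 = 0"
  using G_I[of 1 0] J_eq[of 1 0] by simp_all

lemma J_minus_1 [simp]: "J (-1) = 0"
  using J_eq[of "-1" 0] by simp

lemma G_mult_alpha [simp]: "of_int j * \<alpha> \<in> G" and J_mult_alpha [simp]: "J (of_int j * \<alpha>) = j"
  using G_I[of 0 j] J_eq[of 0 j] by simp_all

lemma G_alpha [simp]: "\<alpha> \<in> G" and J_alpha [simp]: "J \<alpha> = 1"
  using G_mult_alpha[of 1] J_mult_alpha[of 1] by simp_all

lemma G_0 [simp]: "0 \<in> G" and J_0 [simp]: "J 0 = 0"
  using G_I[of 0 0] J_eq[of 0 0] by simp_all

lemma G_add: "a \<in> G \<Longrightarrow> b \<in> G \<Longrightarrow> a + b \<in> G \<and> J (a + b) = J a + J b"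
proof -
  assume "a \<in> G" "b \<in> G"
  then obtain i k where "a = of_int i + of_int (J a) * \<alpha>" "b = of_int k + of_int (J b) * \<alpha>"
    using G_cases by metis
  then have "a + b = of_int (i + k) + of_int (J a + J b) * \<alpha>"
    by (simp add: algebra_simps)
  then show ?thesis
    using G_I J_eq by metis
qed

lemma G_minus: "a \<in> G \<Longrightarrow> - a \<in> G"
proof -
  assume "a \<in> G"
  then obtain i where "a = of_int i + of_int (J a) * \<alpha>"
    by (rule G_cases)
  then have "- a = of_int (- i) + of_int (- J a) * \<alpha>"
    by simp
  then show ?thesis
    using G_I by metis
qed

lemma countable_G: "countable G"
proof -
  have "G = (\<lambda>(i, j). of_int i + of_int j * \<alpha>) ` (UNIV :: (int \<times> int) set)"
    by (auto simp: G_def)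
  then show ?thesis by simp
qed

lemma closure_G: "closure G = UNIV"
proof -
  have "x \<in> closure G" for x
    unfolding closure_approachable
  proof (intro allI impI)
    fix e :: real assume "e > 0"
    then obtain h k where "\<bar>of_int k * \<alpha> - of_int h - x\<bar> < e"
      using sequence_of_fractional_parts_is_dense[OF irrational] by metis
    then have "dist (of_int (-h) + of_int k * \<alpha>) x < e"
      by (simp add: dist_real_def)
    then show "\<exists>y\<in>G. dist y x < e"
      using G_I by blast
  qed
  then show ?thesis by auto
qed

section \<open>Birkhoff sums: cocycle identity, growth and comparison\<close>

lemma S_0 [simp]: "S 0 x = 0"
  by (simp add: S_def)

text \<open>For \<open>j < 0\<close> the new term cancels one term of the subtracted sum, so the
  recursion holds on both sides of zero.\<close>

lemma S_Suc: "S (j + 1) x = S j x + F (x + of_int j * \<alpha>)"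
proof (cases "j \<ge> 0")
  case True
  then have "{0..<j + 1} = insert j {0..<j}" by auto
  with True show ?thesis by (simp add: S_def)
next
  case False
  then have "{j..<0} = insert j {j + 1..<0}" by auto
  with False show ?thesis by (simp add: S_def)
qed

lemma S_1 [simp]: "S 1 x = F x"
  using S_Suc[of 0 x] by simp

lemma S_add: "S (j + k) x = S j x + S k (x + of_int j * \<alpha>)"
proof (induction k rule: int_induct[where k = 0])
  case (step1 k)
  then show ?case
    using S_Suc[of "j + k" x] S_Suc[of k "x + of_int j * \<alpha>"] by (simp add: algebra_simps)
next
  case (step2 k)
  then show ?case
    using S_Suc[of "j + k - 1" x] S_Suc[of "k - 1" "x + of_int j * \<alpha>"] by (simp add: algebra_simps)
qed simp

lemma S_periodic: "S j (x + of_int i) = S j x"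
proof -
  have "F (x + of_int i + t) = F (x + t)" for t
    using periodic_add_int[of F, OF periodic_F, of "x + t" i] by (simp add: algebra_simps)
  then show ?thesis by (simp add: S_def)
qed

lemma continuous_S: "continuous_on A (S j)"
  unfolding S_def[abs_def]
  by (intro continuous_intros continuous_on_compose2[OF continuous_F]) auto

lemma S_minus: "S (- j) x = - S j (x - of_int j * \<alpha>)"
  using S_add[of "-j" j x] by simp

lemma B_add:
  assumes "a \<in> G" "b \<in> G"
  shows "B (a + b) x = B a x + B b (x + a)"
proof -
  obtain i where i: "a = of_int i + of_int (J a) * \<alpha>"
    using assms(1) by (rule G_cases)
  have "S (J b) (x + a) = S (J b) (x + of_int (J a) * \<alpha> + of_int i)"
    by (subst i) (simp add: algebra_simps)
  also have "\<dots> = S (J b) (x + of_int (J a) * \<alpha>)"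
    by (rule S_periodic)
  finally have "S (J b) (x + a) = S (J b) (x + of_int (J a) * \<alpha>)" .
  then show ?thesis
    using assms by (simp add: B_def G_add S_add)
qed

text \<open>\<open>1 / F\<close> is continuous and 1-periodic, hence bounded; inverting its bound
  gives \<open>c\<close>.\<close>

lemma F_lower:
  obtains c where "c > 0" "\<And>x. F x \<ge> c"
proof -
  have "continuous_on UNIV (\<lambda>x. 1 / F x)"
    using continuous_F by (intro continuous_intros) (use positive_F in \<open>auto simp: less_le\<close>)
  then obtain C where C: "C > 0" "\<And>x. \<bar>1 / F x\<bar> \<le> C"
    by (rule continuous_periodic_bounded) (auto simp: periodic_F)
  have "F x \<ge> 1 / C" for x
    using C(2)[of x] C(1) positive_F[of x] by (simp add: field_simps)
  with C(1) show ?thesis by (intro that[of "1 / C"]) auto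
qed

lemma S_lower_nonneg:
  assumes "\<And>x. F x \<ge> c"
  shows "S (int n) x \<ge> c * n"
proof (induction n)
  case (Suc n)
  then show ?case
    using S_Suc[of "int n" x] assms[of "x + int n * \<alpha>"] by (simp add: algebra_simps)
qed simp

text \<open>For positive \<open>c\<close> this converts a bound on the cocycle into a bound on the
  number of summands. Negative \<open>j\<close> reduces to the nonnegative case by
  \<open>S_minus\<close>.\<close>

lemma abs_S_lower:
  assumes "\<And>x. F x \<ge> c"
  shows "\<bar>S j x\<bar> \<ge> c * of_int \<bar>j\<bar>"
proof (cases "j \<ge> 0")
  case True
  then show ?thesis
    using S_lower_nonneg[OF assms, of "nat j" x] by simp
next
  case False
  then show ?thesis
    using S_lower_nonneg[OF assms, of "nat (-j)" "x + of_int j * \<alpha>"] S_minus[of "-j" x] by simp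
qed

lemma S_diff_le:
  assumes "\<And>t. \<bar>F (x + t) - F (y + t)\<bar> \<le> e"
  shows "\<bar>S j x - S j y\<bar> \<le> of_int \<bar>j\<bar> * e"
proof -
  \<comment> \<open>The shift \<open>t\<close> is for negative \<open>j\<close>, where the sums
    start at \<open>x + of_int j * \<alpha>\<close>.\<close>
  have *: "\<bar>S (int n) (x + t) - S (int n) (y + t)\<bar> \<le> n * e" for n t
  proof (induction n)
    case (Suc n)
    then show ?case
      using S_Suc[of "int n"] assms[of "t + int n * \<alpha>"] by (simp add: algebra_simps)
  qed simp
  show ?thesis
  proof (cases "j \<ge> 0")
    case True
    then show ?thesis using *[of "nat j" 0] by simp
  next
    case False
    then show ?thesis
      using *[of "nat (-j)" "of_int j * \<alpha>"] S_minus[of "-j"] by simp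
  qed
qed

section \<open>Rigidity of equivariant maps of the line\<close>

text \<open>Equivariance makes \<open>\<phi> - \<phi> 0\<close> additive in increments from
  \<open>G\<close>; density of \<open>G\<close> and continuity extend this to all
  increments.\<close>

lemma equivariant_imp_affine:
  assumes cont: "continuous_on UNIV \<phi>"
    and eq: "\<And>\<theta>. \<theta> \<in> G \<Longrightarrow> \<exists>\<theta>'. \<forall>x. \<phi> (x + \<theta>) = \<phi> x + \<theta>'"
  obtains \<mu> c where "\<And>x. \<phi> x = \<mu> * x + c"
proof -
  define \<psi> where "\<psi> = (\<lambda>x. \<phi> x - \<phi> 0)"
  have \<psi>: "continuous_on A \<psi>" for A
    unfolding \<psi>_def by (intro continuous_intros continuous_on_subset[OF cont]) auto
  have add: "\<psi> (x + y) = \<psi> x + \<psi> y" for x y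
  proof -
    have "closed {y. \<psi> (x + y) = \<psi> x + \<psi> y}"
      by (intro closed_Collect_eq continuous_intros continuous_on_compose2[OF \<psi>[of UNIV]]) auto
    moreover have "G \<subseteq> {y. \<psi> (x + y) = \<psi> x + \<psi> y}"
    proof
      fix \<theta> assume "\<theta> \<in> G"
      then obtain \<theta>' where "\<forall>x. \<phi> (x + \<theta>) = \<phi> x + \<theta>'" using eq by blast
      \<comment> \<open>The same \<open>\<theta>'\<close> serves at \<open>x\<close> and at 0, so it
        equals \<open>\<psi> \<theta>\<close>.\<close>
      from this[rule_format, of x] this[rule_format, of 0]
      show "\<theta> \<in> {y. \<psi> (x + y) = \<psi> x + \<psi> y}" by (simp add: \<psi>_def)
    qed
    ultimately have "closure G \<subseteq> {y. \<psi> (x + y) = \<psi> x + \<psi> y}"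
      by (rule closure_minimal[rotated])
    then show ?thesis by (auto simp: closure_G)
  qed
  have "\<phi> x = \<psi> 1 * x + \<phi> 0" for x
    using continuous_additive_imp_linear[OF \<psi> add, of x] by (simp add: \<psi>_def)
  then show ?thesis by (rule that)
qed

section \<open>Self-similar cocycles\<close>

text \<open>The multiplier condition is an equivalence, so that the notion passes to the inverse map.\<close>

definition self_similar :: "real \<Rightarrow> real \<Rightarrow> real \<Rightarrow> (real \<Rightarrow> real) \<Rightarrow> bool"
  where "self_similar \<mu> c s g \<longleftrightarrow> \<mu> \<noteq> 0 \<and> s \<noteq> 0 \<and> continuous_on UNIV g \<and>
    (\<forall>\<theta>. \<mu> * \<theta> \<in> G \<longleftrightarrow> \<theta> \<in> G) \<and>
    (\<forall>\<theta>\<in>G. \<forall>x. s * B \<theta> x = B (\<mu> * \<theta>) (\<mu> * x + c) + g (x + \<theta>) - g x)"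

text \<open>The relation at \<open>1 / \<mu> * \<theta>\<close> and at the preimage
  \<open>(y - c) / \<mu>\<close> of \<open>y\<close>, solved for the cocycle there. It turns
  expanding multipliers into contracting ones.\<close>

lemma self_similar_inverse:
  assumes "self_similar \<mu> c s g"
  shows "self_similar (1 / \<mu>) (- c / \<mu>) (1 / s) (\<lambda>y. - g ((y - c) / \<mu>) / s)"
proof -
  have nz: "\<mu> \<noteq> 0" "s \<noteq> 0" and g: "continuous_on UNIV g"
    and G: "\<And>\<theta>. \<mu> * \<theta> \<in> G \<longleftrightarrow> \<theta> \<in> G"
    and eq: "\<And>\<theta> x. \<theta> \<in> G \<Longrightarrow> s * B \<theta> x = B (\<mu> * \<theta>) (\<mu> * x + c) + g (x + \<theta>) - g x"
    using assms by (auto simp: self_similar_def)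
  have G': "1 / \<mu> * \<theta> \<in> G \<longleftrightarrow> \<theta> \<in> G" for \<theta>
    using G[of "1 / \<mu> * \<theta>"] nz by simp
  have "1 / s * B \<theta> y = B (1 / \<mu> * \<theta>) (1 / \<mu> * y + - c / \<mu>)
      + - g ((y + \<theta> - c) / \<mu>) / s - - g ((y - c) / \<mu>) / s" if "\<theta> \<in> G" for \<theta> y
  proof -
    have "s * B (1 / \<mu> * \<theta>) ((y - c) / \<mu>)
        = B \<theta> y + g ((y - c) / \<mu> + 1 / \<mu> * \<theta>) - g ((y - c) / \<mu>)"
      using eq[of "1 / \<mu> * \<theta>" "(y - c) / \<mu>"] that G' nz by simp
    moreover have "(y - c) / \<mu> + 1 / \<mu> * \<theta> = (y + \<theta> - c) / \<mu>" "1 / \<mu> * y + - c / \<mu> = (y - c) / \<mu>"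
      by (simp_all add: diff_divide_distrib add_divide_distrib)
    ultimately have "B \<theta> y = s * B (1 / \<mu> * \<theta>) (1 / \<mu> * y + - c / \<mu>)
        - g ((y + \<theta> - c) / \<mu>) + g ((y - c) / \<mu>)"
      by simp
    then show ?thesis
      using nz(2) by (simp add: field_simps)
  qed
  moreover have "continuous_on UNIV (\<lambda>y. - g ((y - c) / \<mu>) / s)"
    using nz by (intro continuous_intros continuous_on_compose2[OF g]) auto
  ultimately show ?thesis
    unfolding self_similar_def using nz G' by simp
qed

text \<open>With \<open>M\<close> the supremum of \<open>S n\<close> and \<open>C\<close> a bound
  for \<open>g\<close>, the relation gives \<open>\<bar>s\<bar> * M \<le> M + 2 * C\<close>. Since
  \<open>M\<close> grows at least linearly in \<open>n\<close>, \<open>\<bar>s\<bar> > 1\<close> is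
  impossible.\<close>

lemma self_similar_unit_multiplier:
  assumes "self_similar \<mu> c s g" "\<bar>\<mu>\<bar> = 1"
  shows "\<bar>s\<bar> \<le> 1"
proof -
  have g: "continuous_on UNIV g"
    and eq: "\<And>\<theta> x. \<theta> \<in> G \<Longrightarrow> s * B \<theta> x = B (\<mu> * \<theta>) (\<mu> * x + c) + g (x + \<theta>) - g x"
    using assms by (auto simp: self_similar_def)
  have \<mu>: "\<mu> = 1 \<or> \<mu> = -1" using assms(2) by linarith
  \<comment> \<open>At \<theta> = 1 both cocycle terms vanish, since
    \<open>J 1 = J (-1) = 0\<close>.\<close>
  have "g (x + 1) = g x" for x
    using eq[of 1 x] \<mu> by (auto simp: B_def)
  then obtain C where C: "C > 0" "\<And>x. \<bar>g x\<bar> \<le> C"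
    using continuous_periodic_bounded[OF g] by blast
  obtain m where m: "m > 0" "\<And>x. F x \<ge> m"
    using F_lower by blast
  show ?thesis
  proof (rule ccontr)
    assume "\<not> \<bar>s\<bar> \<le> 1"
    then have s: "\<bar>s\<bar> - 1 > 0" by simp
    \<comment> \<open>Large enough that \<open>(\<bar>s\<bar> - 1) * (m * n)\<close> exceeds the
      error \<open>2 * C\<close>.\<close>
    define n where "n = nat \<lceil>2 * C / (m * (\<bar>s\<bar> - 1))\<rceil> + 1"
    have "2 * C / (m * (\<bar>s\<bar> - 1)) < real n"
      unfolding n_def by linarith
    then have n: "2 * C < (\<bar>s\<bar> - 1) * (m * n)"
      using s m(1) by (simp add: field_simps)
    define M where "M = Sup (range (S n))"
    have pos: "m * n \<le> S n x" for x
      using S_lower_nonneg[OF m(2)] .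
    have "bdd_above (range (S n))"
    proof -
      have "S n (x + 1) = S n x" for x
        using S_periodic[of n x 1] by simp
      then obtain K where "\<And>x. \<bar>S n x\<bar> \<le> K"
        using continuous_periodic_bounded[OF continuous_S] by blast
      then show ?thesis
        by (intro bdd_aboveI[of _ K]) (auto intro: order_trans[OF abs_ge_self])
    qed
    then have M: "S n x \<le> M" for x
      unfolding M_def by (intro cSUP_upper) auto
    have le: "\<bar>s\<bar> * S n x \<le> M + 2 * C" for x
    proof -
      have mn: "m * real n \<ge> 0" using m(1) by simp
      \<comment> \<open>For \<open>\<mu> = -1\<close> the value is minus a Birkhoff sum over the
        preceding points, so the same supremum bounds it.\<close>
      have "\<bar>B (\<mu> * (of_int n * \<alpha>)) (\<mu> * x + c)\<bar> \<le> M"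
      proof -
        have "B (- (of_int n * \<alpha>)) y = - S n (y - of_int n * \<alpha>)" for y
          using J_mult_alpha[of "- int n"] by (simp add: B_def S_minus)
        moreover have "B (of_int n * \<alpha>) y = S n y" for y
          by (simp only: B_def J_mult_alpha)
        moreover have "\<bar>S n y\<bar> \<le> M" for y
          using M[of y] pos[of y] mn by linarith
        ultimately show ?thesis using \<mu> by auto
      qed
      moreover have "s * S n x = B (\<mu> * (of_int n * \<alpha>)) (\<mu> * x + c) + g (x + of_int n * \<alpha>) - g x"
        using eq[of "of_int n * \<alpha>" x] unfolding B_def[of "of_int n * \<alpha>"] J_mult_alpha
        by (metis G_mult_alpha)
      moreover have "\<bar>s\<bar> * S n x = \<bar>s * S n x\<bar>"
        using pos[of x] mn by (simp add: abs_mult)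
      ultimately show ?thesis
        using C(2)[of x] C(2)[of "x + of_int n * \<alpha>"] by linarith
    qed
    have "S n x \<le> (M + 2 * C) / \<bar>s\<bar>" for x
      using le[of x] s by (simp add: field_simps)
    then have "M \<le> (M + 2 * C) / \<bar>s\<bar>"
      unfolding M_def by (intro cSUP_least) auto
    then have "(\<bar>s\<bar> - 1) * M \<le> 2 * C"
      using s by (simp add: field_simps)
    moreover have "(\<bar>s\<bar> - 1) * (m * n) \<le> (\<bar>s\<bar> - 1) * M"
      using s pos M by (intro mult_left_mono) (auto intro: order_trans)
    ultimately show False using n by linarith
  qed
qed

text \<open>This is the discreteness of the deck group: bounds on \<open>J \<theta>\<close> and
  \<theta> also bound the integer part, leaving a finite box of coordinates.\<close>

lemma bounded_J_finite:
  "finite {\<theta>\<in>G. \<bar>\<theta>\<bar> \<le> 1 \<and> \<bar>J \<theta>\<bar> \<le> K}"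
proof -
  define N where "N = \<lceil>1 + of_int K * \<bar>\<alpha>\<bar>\<rceil>"
  have "{\<theta>\<in>G. \<bar>\<theta>\<bar> \<le> 1 \<and> \<bar>J \<theta>\<bar> \<le> K}
    \<subseteq> (\<lambda>(i, j). of_int i + of_int j * \<alpha>) ` ({-N..N} \<times> {-K..K})"
  proof
    fix \<theta> assume "\<theta> \<in> {\<theta>\<in>G. \<bar>\<theta>\<bar> \<le> 1 \<and> \<bar>J \<theta>\<bar> \<le> K}"
    then have \<theta>: "\<theta> \<in> G" "\<bar>\<theta>\<bar> \<le> 1" "\<bar>J \<theta>\<bar> \<le> K" by auto
    obtain i where i: "\<theta> = of_int i + of_int (J \<theta>) * \<alpha>"
      using \<theta>(1) by (rule G_cases)
    have "\<bar>of_int (J \<theta>) * \<alpha>\<bar> \<le> of_int K * \<bar>\<alpha>\<bar>"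
      using \<theta>(3) unfolding abs_mult by (intro mult_right_mono) linarith+
    then have "\<bar>of_int i\<bar> \<le> 1 + of_int K * \<bar>\<alpha>\<bar>"
      using i \<theta>(2) by linarith
    then have "\<bar>i\<bar> \<le> N" unfolding N_def by linarith
    with \<theta>(3) have "(i, J \<theta>) \<in> {-N..N} \<times> {-K..K}" by auto
    with i show "\<theta> \<in> (\<lambda>(i, j). of_int i + of_int j * \<alpha>) ` ({-N..N} \<times> {-K..K})"
      by (intro image_eqI[of _ _ "(i, J \<theta>)"]) auto
  qed
  then show ?thesis by (rule finite_subset) auto
qed

lemma self_similar_powers_in_G:
  assumes "self_similar \<mu> c s g" "\<theta> \<in> G"
  shows "\<mu> ^ k * \<theta> \<in> G"
  using assms by (induction k) (auto simp: self_similar_def mult.assoc)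

text \<open>If \<open>\<bar>s\<bar> < 1\<close>, the cocycle at \<open>\<mu> ^ k\<close> along the
  orbit of 0 stays bounded, hence so does \<open>J (\<mu> ^ k)\<close>. Infinitely many distinct
  powers of \<mu> would then lie in the finite set of \<open>bounded_J_finite\<close>.\<close>

lemma self_similar_contracting_multiplier:
  assumes "self_similar \<mu> c s g" "\<bar>\<mu>\<bar> < 1"
  shows "\<bar>s\<bar> \<ge> 1"
proof (rule ccontr)
  assume "\<not> \<bar>s\<bar> \<ge> 1"
  then have s: "\<bar>s\<bar> < 1" by simp
  have nz: "\<mu> \<noteq> 0" and g: "continuous_on UNIV g"
    and eq: "\<And>\<theta> x. \<theta> \<in> G \<Longrightarrow> s * B \<theta> x = B (\<mu> * \<theta>) (\<mu> * x + c) + g (x + \<theta>) - g x"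
    using assms by (auto simp: self_similar_def)
  define l where "l = (\<lambda>x. \<mu> * x + c)"
  \<comment> \<open>The 1 covers the starting points 0 and 1, whose orbits differ by
    \<open>\<mu> ^ k\<close>.\<close>
  define R where "R = 1 + \<bar>c\<bar> / (1 - \<bar>\<mu>\<bar>)"
  obtain C where C: "C > 0" "\<And>x. \<bar>x\<bar> \<le> R \<Longrightarrow> \<bar>g x\<bar> \<le> C"
    using continuous_bounded_interval[OF g] by blast
  obtain m where m: "m > 0" "\<And>x. F x \<ge> m"
    using F_lower by blast
  let ?b = "\<lambda>k. B (\<mu> ^ k) ((l ^^ k) 0)"
  have in_G: "\<mu> ^ k \<in> G" for k
    using self_similar_powers_in_G[OF assms(1), of 1 k] by simp
  \<comment> \<open>The solution of \<open>K = \<bar>s\<bar> * K + 2 * C\<close>, so the bound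
    survives each step of the recursion for \<open>?b\<close>.\<close>
  define K where "K = 2 * C / (1 - \<bar>s\<bar>)"
  have b: "\<bar>?b k\<bar> \<le> K" for k
  proof (induction k)
    case 0
    then show ?case using C(1) s by (simp add: B_def K_def)
  next
    case (Suc k)
    have "\<bar>(l ^^ k) 0\<bar> \<le> R" "\<bar>(l ^^ k) 1\<bar> \<le> R"
      unfolding R_def l_def by (intro contraction_orbit_bounded assms; simp)+
    moreover have "(l ^^ k) 1 = (l ^^ k) 0 + \<mu> ^ k"
      using contraction_orbit_shift[where x = 0 and \<theta> = 1] by (simp add: l_def)
    ultimately have C': "\<bar>g ((l ^^ k) 0)\<bar> \<le> C" "\<bar>g ((l ^^ k) 0 + \<mu> ^ k)\<bar> \<le> C"
      using C(2) by metis+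
    have "s * ?b k = ?b (Suc k) + g ((l ^^ k) 0 + \<mu> ^ k) - g ((l ^^ k) 0)"
      using eq[OF in_G] by (simp add: l_def)
    then have "\<bar>?b (Suc k)\<bar> \<le> \<bar>s * ?b k\<bar> + 2 * C"
      using C' by linarith
    also have "\<dots> \<le> \<bar>s\<bar> * K + 2 * C"
      using Suc unfolding abs_mult by (intro add_mono mult_left_mono) auto
    also have "\<dots> = K"
      using s unfolding K_def by (simp add: field_simps)
    finally show ?case .
  qed
  have "\<bar>J (\<mu> ^ k)\<bar> \<le> \<lceil>K / m\<rceil>" for k
  proof -
    have "m * of_int \<bar>J (\<mu> ^ k)\<bar> \<le> \<bar>?b k\<bar>"
      unfolding B_def by (rule abs_S_lower) (rule m(2))
    also have "\<dots> \<le> K" by (rule b)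
    finally have "of_int \<bar>J (\<mu> ^ k)\<bar> \<le> K / m"
      using m(1) by (simp add: field_simps)
    then show ?thesis by linarith
  qed
  moreover have "\<bar>\<mu> ^ k\<bar> \<le> 1" for k
    using assms(2) by (simp add: power_abs power_le_one)
  ultimately have "range (\<lambda>k::nat. \<mu> ^ k) \<subseteq> {\<theta>\<in>G. \<bar>\<theta>\<bar> \<le> 1 \<and> \<bar>J \<theta>\<bar> \<le> \<lceil>K / m\<rceil>}"
    using in_G by auto
  then have "finite (range (\<lambda>k::nat. \<mu> ^ k))"
    using bounded_J_finite finite_subset by blast
  moreover have "inj (\<lambda>k::nat. \<mu> ^ k)"
  proof (rule injI)
    fix i j :: nat assume "\<mu> ^ i = \<mu> ^ j"
    then have "\<bar>\<mu>\<bar> ^ i = \<bar>\<mu>\<bar> ^ j" by (simp add: power_abs[symmetric])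
    moreover have "\<bar>\<mu>\<bar> ^ b < \<bar>\<mu>\<bar> ^ a" if "a < b" for a b :: nat
      using that assms(2) nz by (intro power_strict_decreasing) auto
    ultimately show "i = j"
      by (metis less_irrefl nat_neq_iff)
  qed
  ultimately show False
    using finite_imageD infinite_UNIV_nat by blast
qed

text \<open>The exact relation for \<open>V\<close> moves its oscillation to points whose distance
  is scaled by \<open>\<mu> ^ k\<close>. The factor \<open>s ^ k\<close> gained is matched by the
  number of summands, so uniform continuity of \<open>F\<close> leaves no oscillation.\<close>

lemma self_similar_contracting_imp_coboundary:
  assumes self_similar: "self_similar \<mu> c s g" and \<mu>: "\<bar>\<mu>\<bar> < 1" and s: "\<bar>s\<bar> > 1"
  shows "\<exists>q h. continuous_on UNIV h \<and> (\<forall>x. h (x + 1) = h x) \<and> (\<forall>x. F x - q = h x - h (x + \<alpha>))"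
proof -
  have g: "continuous_on UNIV g"
    and eq: "\<And>\<theta> x. \<theta> \<in> G \<Longrightarrow> s * B \<theta> x = B (\<mu> * \<theta>) (\<mu> * x + c) + g (x + \<theta>) - g x"
    using self_similar by (auto simp: self_similar_def)
  obtain u where u: "continuous_on UNIV u" "\<And>x. u (\<mu> * x + c) = s * u x + g x"
    using contracting_series[OF g \<mu> s] by blast
  define l where "l = (\<lambda>x. \<mu> * x + c)"
  define V where "V = (\<lambda>\<theta> x. B \<theta> x + u (x + \<theta>) - u x)"
  have V1: "s * V \<theta> x = V (\<mu> * \<theta>) (l x)" if "\<theta> \<in> G" for \<theta> x
    using eq[OF that, of x] u(2)[of x] u(2)[of "x + \<theta>"]
    by (simp add: V_def l_def algebra_simps)
  have Vk: "s ^ k * V \<theta> x = V (\<mu> ^ k * \<theta>) ((l ^^ k) x)" if "\<theta> \<in> G" for k \<theta> x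
  proof (induction k)
    case (Suc k)
    then show ?case
      using V1[OF self_similar_powers_in_G[OF self_similar that], of k "(l ^^ k) x"] by (simp add: mult.assoc)
  qed simp
  obtain m where m: "m > 0" "\<And>x. F x \<ge> m"
    using F_lower by blast
  have V_const: "V \<theta> x = V \<theta> y" if \<theta>: "\<theta> \<in> G" for \<theta> x y
  proof (rule ccontr)
    assume "V \<theta> x \<noteq> V \<theta> y"
    define D where "D = \<bar>V \<theta> x - V \<theta> y\<bar>"
    have D: "D > 0" using \<open>V \<theta> x \<noteq> V \<theta> y\<close> by (simp add: D_def)
    \<comment> \<open>Makes \<open>e / m * \<bar>V \<theta> x\<bar>\<close> smaller than
      \<open>D\<close>; the added 1 keeps the denominator positive when
      \<open>V \<theta> x = 0\<close>.\<close>
    define e where "e = m * D / (2 * (\<bar>V \<theta> x\<bar> + 1))"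
    have "e > 0"
      unfolding e_def using m(1) D by (intro divide_pos_pos mult_pos_pos) auto
    obtain d where d: "d > 0" "\<And>a b. \<bar>a - b\<bar> < d \<Longrightarrow> \<bar>F a - F b\<bar> < e"
      using continuous_periodic_uniform[OF continuous_F periodic_F] \<open>e > 0\<close>
      unfolding uniformly_continuous_on_def dist_real_def by (metis UNIV_I)
    \<comment> \<open>Covers \<open>x\<close>, \<open>y\<close>, \<open>x + \<theta>\<close> and
      \<open>y + \<theta>\<close>, along whose orbits \<open>u\<close> is evaluated.\<close>
    define R where "R = \<bar>x\<bar> + \<bar>y\<bar> + \<bar>\<theta>\<bar>"
    obtain C where C: "C > 0" "\<And>z. \<bar>z\<bar> \<le> R + \<bar>c\<bar> / (1 - \<bar>\<mu>\<bar>) \<Longrightarrow> \<bar>u z\<bar> \<le> C"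
      using continuous_bounded_interval[OF u(1)] by blast
    \<comment> \<open>An estimate at level \<open>k\<close> divided by
      \<open>\<bar>s\<bar> ^ k\<close>: each of the at most
      \<open>(\<bar>s\<bar> ^ k * \<bar>V \<theta> x\<bar> + 2 * C) / m\<close> summands costs at
      most \<open>e\<close>, and the four values of \<open>u\<close> cost
      \<open>4 * C\<close>.\<close>
    have step: "D \<le> e / m * \<bar>V \<theta> x\<bar> + (2 * C * e / m + 4 * C) * (1 / \<bar>s\<bar>) ^ k"
      if k: "\<bar>\<mu>\<bar> ^ k * \<bar>x - y\<bar> < d" for k
    proof -
      define X Y \<eta> where "X = (l ^^ k) x" and "Y = (l ^^ k) y" and "\<eta> = \<mu> ^ k * \<theta>"
      have "X = (l ^^ k) (y + (x - y))" by (simp add: X_def)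
      then have "X - Y = \<mu> ^ k * (x - y)"
        unfolding l_def contraction_orbit_shift Y_def by simp
      then have XY: "\<bar>X - Y\<bar> < d"
        using k by (simp add: abs_mult power_abs)
      have "X + \<eta> = (l ^^ k) (x + \<theta>)" "Y + \<eta> = (l ^^ k) (y + \<theta>)"
        unfolding l_def contraction_orbit_shift X_def Y_def \<eta>_def by simp_all
      then have "\<bar>z\<bar> \<le> R + \<bar>c\<bar> / (1 - \<bar>\<mu>\<bar>)" if "z \<in> {X, Y, X + \<eta>, Y + \<eta>}" for z
        using that unfolding X_def Y_def l_def
        by (auto simp: R_def intro!: contraction_orbit_bounded \<mu>)
      then have uC: "\<bar>u X\<bar> \<le> C" "\<bar>u Y\<bar> \<le> C" "\<bar>u (X + \<eta>)\<bar> \<le> C" "\<bar>u (Y + \<eta>)\<bar> \<le> C"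
        by (auto intro!: C(2))
      have VX: "s ^ k * V \<theta> x = V \<eta> X" and VY: "s ^ k * V \<theta> y = V \<eta> Y"
        unfolding X_def Y_def \<eta>_def using Vk[OF \<theta>] by auto
      have sk: "\<bar>s\<bar> ^ k > 0" using s by simp
      let ?j = "of_int \<bar>J \<eta>\<bar> :: real"
      have "m * ?j \<le> \<bar>B \<eta> X\<bar>"
        unfolding B_def by (rule abs_S_lower) (rule m(2))
      also have "\<dots> \<le> \<bar>V \<eta> X\<bar> + 2 * C"
        using uC by (simp add: V_def)
      also have "\<bar>V \<eta> X\<bar> = \<bar>s\<bar> ^ k * \<bar>V \<theta> x\<bar>"
        unfolding VX[symmetric] by (simp add: abs_mult power_abs)
      finally have j: "?j \<le> (\<bar>s\<bar> ^ k * \<bar>V \<theta> x\<bar> + 2 * C) / m"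
        using m(1) by (simp add: field_simps)
      have "\<bar>B \<eta> X - B \<eta> Y\<bar> \<le> ?j * e"
        unfolding B_def by (rule S_diff_le) (use d(2) XY in \<open>simp add: less_imp_le\<close>)
      then have "\<bar>V \<eta> X - V \<eta> Y\<bar> \<le> ?j * e + 4 * C"
        using uC unfolding V_def by linarith
      also have "\<dots> \<le> (\<bar>s\<bar> ^ k * \<bar>V \<theta> x\<bar> + 2 * C) / m * e + 4 * C"
        using j \<open>e > 0\<close> by (intro add_right_mono mult_right_mono) auto
      also have "\<bar>V \<eta> X - V \<eta> Y\<bar> = \<bar>s\<bar> ^ k * D"
        unfolding VX[symmetric] VY[symmetric] D_def
        by (simp add: right_diff_distrib[symmetric] abs_mult power_abs)
      finally have "D \<le> ((\<bar>s\<bar> ^ k * \<bar>V \<theta> x\<bar> + 2 * C) / m * e + 4 * C) / \<bar>s\<bar> ^ k"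
        using sk by (simp add: field_simps)
      also have "\<dots> = e / m * \<bar>V \<theta> x\<bar> + (2 * C * e / m + 4 * C) * (1 / \<bar>s\<bar>) ^ k"
        using sk m(1) by (simp add: field_simps power_divide)
      finally show ?thesis .
    qed
    have "(\<lambda>k. \<bar>\<mu>\<bar> ^ k * \<bar>x - y\<bar>) \<longlonglongrightarrow> 0 * \<bar>x - y\<bar>"
      using \<mu> by (intro tendsto_intros LIMSEQ_realpow_zero) auto
    then have "\<forall>\<^sub>F k in sequentially. \<bar>\<mu>\<bar> ^ k * \<bar>x - y\<bar> < d"
      using d(1) by (intro order_tendstoD(2)) auto
    then have "\<forall>\<^sub>F k in sequentially.
        D \<le> e / m * \<bar>V \<theta> x\<bar> + (2 * C * e / m + 4 * C) * (1 / \<bar>s\<bar>) ^ k"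
      by eventually_elim (rule step)
    moreover have "(\<lambda>k. e / m * \<bar>V \<theta> x\<bar> + (2 * C * e / m + 4 * C) * (1 / \<bar>s\<bar>) ^ k)
        \<longlonglongrightarrow> e / m * \<bar>V \<theta> x\<bar> + (2 * C * e / m + 4 * C) * 0"
      using s by (intro tendsto_intros LIMSEQ_realpow_zero) auto
    ultimately have "D \<le> e / m * \<bar>V \<theta> x\<bar>"
      using tendsto_lowerbound[of _ _ sequentially D] by fastforce
    also have "\<dots> = D * (\<bar>V \<theta> x\<bar> / (2 * (\<bar>V \<theta> x\<bar> + 1)))"
      unfolding e_def using m(1) by simp
    also have "\<dots> < D * 1"
      using D by (intro mult_strict_left_mono) (simp_all add: divide_less_eq)
    finally show False by simp
  qed
  \<comment> \<open>\<open>B 1\<close> vanishes, so \<open>p\<close> is the constant increment of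
    \<open>u\<close> over a unit step; subtracting \<open>p * x\<close> makes \<open>u\<close>
    periodic and changes the constant for \<alpha> by \<open>p * \<alpha>\<close>.\<close>
  define p where "p = V 1 0"
  define h where "h = (\<lambda>x. u x - p * x)"
  have u1: "u (x + 1) - u x = p" for x
    using V_const[OF G_1, of x 0] by (simp add: V_def p_def B_def)
  have u\<alpha>: "F x + u (x + \<alpha>) - u x = V \<alpha> 0" for x
    using V_const[OF G_alpha, of x 0] by (simp add: V_def B_def)
  show ?thesis
  proof (intro exI conjI allI)
    show "continuous_on UNIV h"
      unfolding h_def by (intro continuous_intros u(1))
    show "h (x + 1) = h x" for x
      using u1[of x] by (simp add: h_def algebra_simps)
    show "F x - (V \<alpha> 0 - p * \<alpha>) = h x - h (x + \<alpha>)" for x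
      using u\<alpha>[of x] by (simp add: h_def algebra_simps)
  qed
qed

text \<open>A contraction is handled directly, an expansion through its inverse. For modulus one,
  the bound in both directions forces \<open>\<bar>s\<bar> = 1\<close>, which is excluded.\<close>

lemma self_similar_imp_coboundary:
  assumes "self_similar \<mu> c s g" "\<bar>s\<bar> \<noteq> 1"
  shows "\<exists>q h. continuous_on UNIV h \<and> (\<forall>x. h (x + 1) = h x) \<and> (\<forall>x. F x - q = h x - h (x + \<alpha>))"
proof -
  have contracting: ?thesis if "self_similar \<mu> c s g" "\<bar>\<mu>\<bar> < 1" "\<bar>s\<bar> \<noteq> 1" for \<mu> c s g
  proof -
    have "\<bar>s\<bar> > 1"
      using self_similar_contracting_multiplier[OF that(1,2)] that(3) by linarith
    with that(1,2) show ?thesis by (rule self_similar_contracting_imp_coboundary)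
  qed
  have nz: "\<mu> \<noteq> 0" "s \<noteq> 0" using assms(1) by (auto simp: self_similar_def)
  note inverse = self_similar_inverse[OF assms(1)]
  consider "\<bar>\<mu>\<bar> < 1" | "\<bar>\<mu>\<bar> = 1" | "\<bar>\<mu>\<bar> > 1" by linarith
  then show ?thesis
  proof cases
    case 1
    then show ?thesis by (intro contracting[OF assms(1) _ assms(2)])
  next
    case 2
    then have "\<bar>s\<bar> \<le> 1" "\<bar>1 / s\<bar> \<le> 1"
      using self_similar_unit_multiplier[OF assms(1)] self_similar_unit_multiplier[OF inverse] by simp_all
    then have "\<bar>s\<bar> = 1" using nz by simp
    with assms(2) show ?thesis by simp
  next
    case 3
    show ?thesis
      by (rule contracting[OF inverse]) (use 3 nz assms(2) in auto)
  qed
qed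

end

section \<open>The covering of the special flow space by the plane\<close>

lemma to_circle_eq_iff: "to_circle x = to_circle y \<longleftrightarrow> x - y \<in> \<int>"
  by (rule circle.abs_eq_iff)

lemma to_circle_add: "to_circle (x + y) = to_circle x + to_circle y"
  by (simp add: plus_circle.abs_eq)

lemma to_circle_cases:
  obtains x where "y = to_circle x"
  by (metis Quotient_abs_rep[OF Quotient_circle])

lemma continuous_on_to_circle: "continuous_on A to_circle"
  by (rule continuous_on_subset[of UNIV])
     (auto simp: continuous_on_open_vimage open_circle_def)

text \<open>The saturation of \<open>U\<close> is the union of its integer translates, each of them
  open.\<close>

lemma open_to_circle_image:
  assumes "open U"
  shows "open (to_circle ` U)"
proof -
  have "to_circle -` (to_circle ` U) = (\<Union>i::int. (\<lambda>x. x - of_int i) -` U)"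
  proof (intro equalityI subsetI)
    fix x assume "x \<in> to_circle -` (to_circle ` U)"
    then obtain u where "u \<in> U" "x - u \<in> \<int>"
      by (auto simp: to_circle_eq_iff)
    then obtain i where "x - u = of_int i"
      by (auto elim: Ints_cases)
    with \<open>u \<in> U\<close> show "x \<in> (\<Union>i::int. (\<lambda>x. x - of_int i) -` U)"
      by (intro UN_I[of i]) (auto simp: algebra_simps)
  next
    fix x assume "x \<in> (\<Union>i::int. (\<lambda>x. x - of_int i) -` U)"
    then obtain i :: int where "x - of_int i \<in> U" by auto
    moreover have "to_circle x = to_circle (x - of_int i)"
      by (simp add: to_circle_eq_iff)
    ultimately show "x \<in> to_circle -` (to_circle ` U)" by auto
  qed
  moreover have "open ((\<lambda>x. x - of_int i) -` U)" for i :: int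
    using assms by (intro open_vimage continuous_intros)
  ultimately show ?thesis
    unfolding open_circle_def by auto
qed

locale irrational_special_flow =
  fixes \<alpha> :: real and f :: "circle \<Rightarrow> real"
  assumes irrational: "\<alpha> \<notin> \<rat>"
    and continuous_f: "continuous_on UNIV f"
    and positive_f: "\<And>x. f x > 0"
begin

sublocale irrational_roof \<alpha> "\<lambda>x. f (to_circle x)"
proof
  show "continuous_on UNIV (\<lambda>x. f (to_circle x))"
    by (rule continuous_on_compose2[OF continuous_f continuous_on_to_circle]) auto
  show "f (to_circle (x + 1)) = f (to_circle x)" for x
    by (rule arg_cong[of _ _ f]) (simp add: to_circle_eq_iff)
qed (use irrational positive_f in auto)

section \<open>The deck group and the orbit projection\<close>

text \<open>For \<open>\<theta> \<in> G\<close> a deck transformation: an integer translation of the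
  base combined with a lift of the \<open>J \<theta>\<close>-th power of
  \<open>skew \<alpha> f\<close>.\<close>

definition act :: "real \<Rightarrow> real \<times> real \<Rightarrow> real \<times> real"
  where "act \<theta> = (\<lambda>(x, r). (x + \<theta>, r - B \<theta> x))"

definition cover :: "real \<times> real \<Rightarrow> circle \<times> real"
  where "cover = (\<lambda>(x, r). (to_circle x, r))"

definition proj :: "real \<times> real \<Rightarrow> (circle \<times> real) set"
  where "proj p = orbit_rel (skew \<alpha> f) `` {cover p}"

abbreviation X :: "(circle \<times> real) set topology"
  where "X \<equiv> special_flow_space \<alpha> f"

lemma act_0 [simp]: "act 0 p = p"
  by (simp add: act_def B_def split: prod.split)

lemma act_act:
  assumes "\<theta> \<in> G" "\<eta> \<in> G"
  shows "act \<eta> (act \<theta> p) = act (\<theta> + \<eta>) p"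
  using assms by (simp add: act_def B_add add.assoc split: prod.split)

lemma act_minus:
  assumes "\<theta> \<in> G"
  shows "act (- \<theta>) (act \<theta> p) = p" "act \<theta> (act (- \<theta>) p) = p"
  using act_act[of \<theta> "- \<theta>" p] act_act[of "- \<theta>" \<theta> p] assms G_minus by auto

lemma continuous_on_act: "continuous_on A (act \<theta>)"
  unfolding act_def case_prod_unfold B_def
  by (intro continuous_intros continuous_on_compose2[OF continuous_S[of UNIV]]) auto

lemma act_image_eq_vimage:
  assumes "\<theta> \<in> G"
  shows "act \<theta> ` V = act (- \<theta>) -` V"
  using act_minus[OF assms] by (auto simp: image_iff) metis

lemma skew_funpow: "(skew \<alpha> f ^^ n) (cover (x, r)) = cover (x + of_int (int n) * \<alpha>, r - S (int n) x)"
proof (induction n)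
  case (Suc n)
  have "S (int (Suc n)) x = S (int n) x + f (to_circle (x + of_int (int n) * \<alpha>))"
    using S_Suc[of "int n" x] by (simp add: algebra_simps)
  with Suc show ?case
    by (simp add: skew_def cover_def to_circle_add[symmetric] algebra_simps)
qed simp

lemma cover_eq_iff: "cover p = cover q \<longleftrightarrow> (\<exists>i::int. q = (fst p + of_int i, snd p))"
proof -
  have "cover p = cover q \<longleftrightarrow> fst q - fst p \<in> \<int> \<and> snd q = snd p"
    using to_circle_eq_iff[of "fst q" "fst p"]
    by (auto simp: cover_def case_prod_unfold)
  also have "\<dots> \<longleftrightarrow> (\<exists>i::int. q = (fst p + of_int i, snd p))"
    by (cases q) (auto simp: algebra_simps elim!: Ints_cases)
  finally show ?thesis .
qed

text \<open>Identifies the fibres of the projection with the deck orbits. The relation uses natural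
  powers only, so negative \<open>J \<theta>\<close> is treated by exchanging \<open>p\<close> and
  \<open>q\<close>.\<close>

lemma orbit_rel_cover:
  "(cover p, cover q) \<in> orbit_rel (skew \<alpha> f) \<longleftrightarrow> (\<exists>\<theta>\<in>G. q = act \<theta> p)"
proof -
  have forward: "cover q = (skew \<alpha> f ^^ n) (cover p) \<longleftrightarrow> (\<exists>i::int. q = act (of_int i + of_int (int n) * \<alpha>) p)"
    for p q n
  proof -
    have "cover q = (skew \<alpha> f ^^ n) (cover p)
        \<longleftrightarrow> cover (fst p + of_int (int n) * \<alpha>, snd p - S (int n) (fst p)) = cover q"
      using skew_funpow[of n "fst p" "snd p"] by auto
    also have "\<dots> \<longleftrightarrow> (\<exists>i::int. q = act (of_int i + of_int (int n) * \<alpha>) p)"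
      unfolding cover_eq_iff act_def B_def J_eq case_prod_unfold by (simp add: ac_simps)
    finally show ?thesis .
  qed
  show ?thesis
  proof
    assume "(cover p, cover q) \<in> orbit_rel (skew \<alpha> f)"
    then obtain n where "cover q = (skew \<alpha> f ^^ n) (cover p) \<or> cover p = (skew \<alpha> f ^^ n) (cover q)"
      by (auto simp: orbit_rel_def)
    then obtain i :: int where
      "q = act (of_int i + of_int (int n) * \<alpha>) p \<or> p = act (of_int i + of_int (int n) * \<alpha>) q"
      unfolding forward by auto
    then show "\<exists>\<theta>\<in>G. q = act \<theta> p"
      using act_minus(1) G_minus G_I by metis
  next
    assume "\<exists>\<theta>\<in>G. q = act \<theta> p"
    then obtain \<theta> where \<theta>: "\<theta> \<in> G" "q = act \<theta> p" by blast
    obtain i where i: "\<theta> = of_int i + of_int (J \<theta>) * \<alpha>"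
      using \<theta>(1) by (rule G_cases)
    show "(cover p, cover q) \<in> orbit_rel (skew \<alpha> f)"
    proof (cases "J \<theta> \<ge> 0")
      case True
      then have "\<theta> = of_int i + of_int (int (nat (J \<theta>))) * \<alpha>" using i by simp
      then have "cover q = (skew \<alpha> f ^^ nat (J \<theta>)) (cover p)"
        unfolding forward using \<theta>(2) by metis
      then show ?thesis by (auto simp: orbit_rel_def)
    next
      case False
      then have "- \<theta> = of_int (- i) + of_int (int (nat (- J \<theta>))) * \<alpha>" using i by simp
      moreover have "p = act (- \<theta>) q" using \<theta> act_minus by simp
      ultimately have "cover p = (skew \<alpha> f ^^ nat (- J \<theta>)) (cover q)"
        unfolding forward by metis
      then show ?thesis by (auto simp: orbit_rel_def)
    qed
  qed
qed

lemma equiv_orbit: "equiv UNIV (orbit_rel (skew \<alpha> f))"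
  by (rule equiv_orbit_rel[OF bij_skew])

lemma proj_eq_iff: "proj p = proj q \<longleftrightarrow> (\<exists>\<theta>\<in>G. q = act \<theta> p)"
  unfolding proj_def orbit_rel_cover[symmetric]
  by (rule eq_equiv_class_iff[OF equiv_orbit]) auto

lemma proj_act [simp]: "\<theta> \<in> G \<Longrightarrow> proj (act \<theta> p) = proj p"
  using proj_eq_iff by metis

lemma cover_surj:
  obtains p where "y = cover p"
proof -
  obtain x where "fst y = to_circle x" by (rule to_circle_cases)
  then have "y = cover (x, snd y)" by (simp add: cover_def prod_eq_iff)
  then show ?thesis by (rule that)
qed

lemma topspace_X: "topspace X = range proj"
proof -
  have "topspace X = UNIV // orbit_rel (skew \<alpha> f)"
    unfolding special_flow_space_def by (rule topspace_quotient_topology[OF equiv_orbit])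
  also have "\<dots> = range proj"
  proof (intro equalityI subsetI)
    fix c assume "c \<in> UNIV // orbit_rel (skew \<alpha> f)"
    then obtain y where y: "c = orbit_rel (skew \<alpha> f) `` {y}" by (auto elim: quotientE)
    obtain p where "y = cover p" by (rule cover_surj)
    with y show "c \<in> range proj" by (auto simp: proj_def)
  qed (auto simp: proj_def intro: quotientI)
  finally show ?thesis .
qed

lemma openin_X: "openin X U \<longleftrightarrow> U \<subseteq> range proj \<and> open (\<Union>U)"
  using openin_quotient_topology[OF equiv_orbit] topspace_quotient_topology[OF equiv_orbit] topspace_X
  unfolding special_flow_space_def by metis

lemma mem_proj: "cover q \<in> proj p \<longleftrightarrow> proj p = proj q"
  unfolding proj_eq_iff orbit_rel_cover[symmetric] by (simp add: proj_def)

lemma continuous_map_proj: "continuous_map euclidean X proj"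
proof -
  have "open {p. proj p \<in> U}" if U: "openin X U" for U
  proof -
    have "{p. proj p \<in> U} = cover -` \<Union>U"
    proof (intro equalityI subsetI)
      fix p assume "p \<in> cover -` \<Union>U"
      then obtain c where "c \<in> U" "cover p \<in> c" by auto
      moreover from this obtain q where "c = proj q" using U by (auto simp: openin_X)
      ultimately show "p \<in> {p. proj p \<in> U}" by (simp add: mem_proj)
    qed (metis (mono_tags) UnionI mem_Collect_eq mem_proj vimageI)
    moreover have "continuous_on UNIV cover"
      unfolding cover_def case_prod_unfold
      by (intro continuous_intros continuous_on_compose2[OF continuous_on_to_circle[of UNIV]]) auto
    ultimately show ?thesis
      using U by (simp add: openin_X open_vimage)
  qed
  then show ?thesis
    by (simp add: continuous_map_def topspace_X)
qed

text \<open>The saturation of \<open>V\<close> in the plane is the union of its deck translates,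
  open because each \<open>act (- \<theta>)\<close> is continuous; \<open>cover\<close> is an open
  map.\<close>

lemma openin_proj_image:
  assumes "open V"
  shows "openin X (proj ` V)"
proof -
  have "\<Union>(proj ` V) = cover ` (\<Union>\<theta>\<in>G. act \<theta> ` V)"
  proof (intro equalityI subsetI)
    fix y assume y: "y \<in> \<Union>(proj ` V)"
    obtain q where q: "y = cover q" by (rule cover_surj)
    from y obtain p where "p \<in> V" "proj p = proj q"
      unfolding q by (auto simp: mem_proj)
    then show "y \<in> cover ` (\<Union>\<theta>\<in>G. act \<theta> ` V)"
      unfolding q proj_eq_iff by auto
  qed (auto simp: mem_proj)
  moreover have "open (cover ` W)" if W: "open W" for W
  proof (rule open_prod_intro)
    fix y assume "y \<in> cover ` W"
    then obtain x r where xr: "(x, r) \<in> W" and "y = (to_circle x, r)"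
      by (auto simp: cover_def)
    moreover obtain A C where "open A" "open C" "x \<in> A" "r \<in> C" "A \<times> C \<subseteq> W"
      by (rule open_prod_elim[OF W xr]) auto
    moreover have "to_circle ` A \<times> C = cover ` (A \<times> C)"
      by (force simp: cover_def)
    ultimately show "\<exists>A C. open A \<and> open C \<and> y \<in> A \<times> C \<and> A \<times> C \<subseteq> cover ` W"
      by (intro exI[of _ "to_circle ` A"] exI[of _ C]) (auto intro: open_to_circle_image)
  qed
  moreover have "open (\<Union>\<theta>\<in>G. act \<theta> ` V)"
    using assms by (intro open_UN ballI) (simp add: act_image_eq_vimage open_vimage continuous_on_act)
  ultimately show ?thesis
    by (auto simp: openin_X)
qed

lemma special_flow_proj: "special_flow t (proj (x, r)) = proj (x, r + t)"
  by (simp add: proj_def cover_def special_flow_class)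

section \<open>Lifting curves to the plane\<close>

text \<open>A height change below the minimum of the roof forces \<open>J \<theta> = 0\<close>; then
  \<theta> is an integer of modulus below 1. The uniform \<open>e\<close> makes \<open>proj\<close>
  injective on small balls.\<close>

lemma act_separated:
  obtains e where "e > 0" "\<And>\<theta> p. \<theta> \<in> G \<Longrightarrow> dist p (act \<theta> p) < e \<Longrightarrow> \<theta> = 0"
proof -
  obtain m where m: "m > 0" "\<And>x. f (to_circle x) \<ge> m"
    using F_lower by blast
  show ?thesis
  proof (rule that)
    show "min m 1 > 0" using m by simp
    fix \<theta> p assume \<theta>: "\<theta> \<in> G" and d: "dist p (act \<theta> p) < min m 1"
    have "\<bar>\<theta>\<bar> < 1"
      using dist_fst_le[of p "act \<theta> p"] d by (auto simp: act_def dist_real_def case_prod_unfold)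
    have "\<bar>S (J \<theta>) (fst p)\<bar> < m"
      using dist_snd_le[of p "act \<theta> p"] d by (auto simp: act_def dist_real_def case_prod_unfold B_def)
    then have "m * of_int \<bar>J \<theta>\<bar> < m * 1"
      using abs_S_lower[of m "J \<theta>" "fst p"] m(2) by auto
    then have "of_int \<bar>J \<theta>\<bar> < (1::real)"
      using m(1) by (simp only: mult_less_cancel_left_pos)
    then have "J \<theta> = 0" by linarith
    then obtain i where "\<theta> = of_int i"
      using G_cases[OF \<theta>] by auto
    with \<open>\<bar>\<theta>\<bar> < 1\<close> show "\<theta> = 0" by simp
  qed
qed

text \<open>A deck transformation is read off from the change of the first coordinate. That change
  is continuous on a connected set with values in the countable \<open>G\<close>, hence
  constant.\<close>

lemma lift_unique:
  assumes "connected A" "continuous_on A L" "continuous_on A L'"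
    and "\<And>x. x \<in> A \<Longrightarrow> proj (L x) = proj (L' x)"
  shows "\<exists>\<theta>\<in>G. \<forall>x\<in>A. L' x = act \<theta> (L x)"
proof (cases "A = {}")
  case True
  then show ?thesis using G_0 by auto
next
  case False
  then obtain a where a: "a \<in> A" by blast
  let ?d = "\<lambda>x. fst (L' x) - fst (L x)"
  have d: "?d x \<in> G \<and> L' x = act (?d x) (L x)" if x: "x \<in> A" for x
  proof -
    obtain \<theta> where "\<theta> \<in> G" "L' x = act \<theta> (L x)"
      using assms(4)[OF x] proj_eq_iff by auto
    moreover from this have "?d x = \<theta>" by (simp add: act_def case_prod_unfold)
    ultimately show ?thesis by simp
  qed
  have "connected (?d ` A)"
    using assms by (intro connected_continuous_image continuous_intros)
  moreover have "countable (?d ` A)"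
    using d by (intro countable_subset[OF _ countable_G]) auto
  ultimately have "?d x = ?d a" if "x \<in> A" for x
    using connected_uncountable[of "?d ` A" "?d x" "?d a"] a that by blast
  then show ?thesis
    using d a by (intro bexI[of _ "?d a"]) (metis, blast)
qed

text \<open>On a ball of radius \<open>e / 2\<close> the open map \<open>proj\<close> is injective,
  so its inverse there is continuous and composes with \<open>\<gamma>\<close>.\<close>

lemma local_lift:
  assumes \<gamma>: "continuous_map euclideanreal X \<gamma>"
  shows "\<exists>d>0. \<exists>L. continuous_on (ball x d) L \<and> (\<forall>y\<in>ball x d. proj (L y) = \<gamma> y)"
proof -
  obtain e where e: "e > 0" "\<And>\<theta> p. \<theta> \<in> G \<Longrightarrow> dist p (act \<theta> p) < e \<Longrightarrow> \<theta> = 0"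
    by (rule act_separated) blast
  have "\<gamma> x \<in> topspace X"
    using continuous_map_image_subset_topspace[OF \<gamma>] by auto
  then obtain p where p: "\<gamma> x = proj p"
    unfolding topspace_X by blast
  define U where "U = ball p (e / 2)"
  have open_pre: "open {y. \<gamma> y \<in> proj ` W}" if "open W" for W
    using openin_continuous_map_preimage[OF \<gamma> openin_proj_image[OF that]] by simp
  have "open {y. \<gamma> y \<in> proj ` U}" "x \<in> {y. \<gamma> y \<in> proj ` U}"
    using e(1) p by (auto simp: U_def intro!: open_pre)
  then obtain d where d: "d > 0" "ball x d \<subseteq> {y. \<gamma> y \<in> proj ` U}"
    by (rule openE) blast
  define L where "L = (\<lambda>y. SOME q. q \<in> U \<and> proj q = \<gamma> y)"
  have L: "L y \<in> U \<and> proj (L y) = \<gamma> y" if "y \<in> ball x d" for y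
  proof -
    have "\<gamma> y \<in> proj ` U" using d(2) that by blast
    then have "\<exists>q. q \<in> U \<and> proj q = \<gamma> y" by (metis imageE)
    then show ?thesis unfolding L_def by (rule someI_ex)
  qed
  have inj: "q = q'" if U: "q \<in> U" "q' \<in> U" and eq: "proj q = proj q'" for q q'
  proof -
    obtain \<theta> where \<theta>: "\<theta> \<in> G" "q' = act \<theta> q"
      using eq proj_eq_iff by auto
    have "dist q q' < e"
      using U dist_triangle_half_l[of q p e q'] by (simp add: U_def dist_commute)
    with \<theta> e(2) have "\<theta> = 0" by simp
    with \<theta> show ?thesis by simp
  qed
  have "L -` V \<inter> ball x d = {y. \<gamma> y \<in> proj ` (V \<inter> U)} \<inter> ball x d" for V
  proof (intro equalityI subsetI)
    fix y assume "y \<in> L -` V \<inter> ball x d"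
    then show "y \<in> {y. \<gamma> y \<in> proj ` (V \<inter> U)} \<inter> ball x d"
      using L[of y] by (auto intro!: image_eqI[of _ _ "L y"])
  next
    fix y assume "y \<in> {y. \<gamma> y \<in> proj ` (V \<inter> U)} \<inter> ball x d"
    then obtain q where q: "q \<in> V" "q \<in> U" "\<gamma> y = proj q" "y \<in> ball x d" by auto
    then have "L y = q" using L[of y] inj[of "L y" q] by auto
    with q show "y \<in> L -` V \<inter> ball x d" by simp
  qed
  then have "continuous_on (ball x d) L"
    by (auto simp: continuous_on_open_vimage U_def intro!: open_Int open_pre)
  with L d(1) show ?thesis by blast
qed

text \<open>Quantifying over all starting points \<open>p\<close> lets lifts over adjacent intervals
  be concatenated; locally, a deck transformation moves the lift to the prescribed start.\<close>

lemma interval_lift: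
  assumes \<gamma>: "continuous_map euclideanreal X \<gamma>" and "a \<le> b"
  shows "\<forall>p. proj p = \<gamma> a \<longrightarrow> (\<exists>L. continuous_on {a..b} L \<and> L a = p \<and> (\<forall>x\<in>{a..b}. proj (L x) = \<gamma> x))"
  using \<open>a \<le> b\<close>
proof (induction a b rule: Bolzano)
  case (trans a b c)
  show ?case
  proof (intro allI impI)
    fix p assume "proj p = \<gamma> a"
    then obtain L where L: "continuous_on {a..b} L" "L a = p" "\<forall>x\<in>{a..b}. proj (L x) = \<gamma> x"
      using trans(1) by blast
    have "proj (L b) = \<gamma> b" using L(3) trans(3) by simp
    then obtain M where M: "continuous_on {b..c} M" "M b = L b" "\<forall>x\<in>{b..c}. proj (M x) = \<gamma> x"
      using trans(2) by blast
    let ?N = "\<lambda>x. if x \<le> b then L x else M x"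
    have "{a..c} = {a..b} \<union> {b..c}" using trans(3,4) by auto
    moreover have "continuous_on ({a..b} \<union> {b..c}) ?N"
      by (rule continuous_on_cases) (use L M in \<open>auto dest!: antisym\<close>)
    ultimately have "continuous_on {a..c} ?N" by simp
    moreover have "?N a = p" using L trans(3) by simp
    moreover have "\<forall>x\<in>{a..c}. proj (?N x) = \<gamma> x" using L M by auto
    ultimately show "\<exists>L. continuous_on {a..c} L \<and> L a = p \<and> (\<forall>x\<in>{a..c}. proj (L x) = \<gamma> x)"
      by blast
  qed
next
  case (local x)
  obtain d L where d: "d > 0" and L: "continuous_on (ball x d) L" "\<forall>y\<in>ball x d. proj (L y) = \<gamma> y"
    using local_lift[OF \<gamma>] by blast
  show ?case
  proof (intro exI[of _ d] conjI d allI impI)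
    fix a b p assume ab: "a \<le> x \<and> x \<le> b \<and> b - a < d" and p: "proj p = \<gamma> a"
    have sub: "{a..b} \<subseteq> ball x d" using ab by (auto simp: dist_real_def)
    moreover have "a \<in> {a..b}" using ab by auto
    ultimately have "proj (L a) = proj p" using L(2) p by auto
    then obtain \<theta> where \<theta>: "\<theta> \<in> G" "p = act \<theta> (L a)"
      using proj_eq_iff by auto
    have "continuous_on {a..b} (\<lambda>y. act \<theta> (L y))"
      by (rule continuous_on_compose2[OF continuous_on_act[of UNIV] continuous_on_subset[OF L(1) sub]]) simp
    with \<theta> L(2) sub
    show "\<exists>L. continuous_on {a..b} L \<and> L a = p \<and> (\<forall>x\<in>{a..b}. proj (L x) = \<gamma> x)"
      by (intro exI[of _ "\<lambda>y. act \<theta> (L y)"]) auto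
  qed
qed

text \<open>Lifts over growing intervals, all normalised to \<open>p\<close> at 0, agree by
  uniqueness and glue together.\<close>

lemma line_lift:
  assumes \<gamma>: "continuous_map euclideanreal X \<gamma>"
  obtains L where "continuous_on UNIV L" "\<And>x. proj (L x) = \<gamma> x"
proof -
  have top: "\<gamma> x \<in> range proj" for x
    using continuous_map_image_subset_topspace[OF \<gamma>] topspace_X by auto
  obtain p where p: "proj p = \<gamma> 0" using top[of 0] by auto
  have "\<exists>L. continuous_on {-real n..real n} L \<and> L 0 = p \<and> (\<forall>x\<in>{-real n..real n}. proj (L x) = \<gamma> x)" for n
  proof -
    \<comment> \<open>\<open>interval_lift\<close> prescribes the value at the left endpoint, so the
      value at 0 is corrected afterwards by a deck transformation.\<close>
    obtain q where "proj q = \<gamma> (- real n)" using top[of "- real n"] by auto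
    then obtain L where L: "continuous_on {-real n..real n} L" "\<forall>x\<in>{-real n..real n}. proj (L x) = \<gamma> x"
      using interval_lift[OF \<gamma>, of "- real n" "real n"] of_nat_0_le_iff[of n] by (metis neg_le_0_iff_le order_trans)
    then have "proj (L 0) = proj p" using p by simp
    then obtain \<theta> where \<theta>: "\<theta> \<in> G" "p = act \<theta> (L 0)"
      using proj_eq_iff by auto
    have "continuous_on {-real n..real n} (\<lambda>y. act \<theta> (L y))"
      by (rule continuous_on_compose2[OF continuous_on_act[of UNIV] L(1)]) simp
    with \<theta> L(2) show ?thesis
      by (intro exI[of _ "\<lambda>y. act \<theta> (L y)"]) auto
  qed
  then obtain L where L: "\<And>n. continuous_on {-real n..real n} (L n)" "\<And>n. L n 0 = p"
      "\<And>n x. x \<in> {-real n..real n} \<Longrightarrow> proj (L n x) = \<gamma> x"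
    by metis
  have agree: "L n x = L m x" if "n \<le> m" "x \<in> {-real n..real n}" for n m x
  proof -
    have sub: "{-real n..real n} \<subseteq> {-real m..real m}" using that(1) by auto
    obtain \<theta> where "\<theta> \<in> G" and \<theta>: "\<forall>x\<in>{-real n..real n}. L m x = act \<theta> (L n x)"
      using lift_unique[of "{-real n..real n}" "L n" "L m"] L(1)[of n] L(3)[of _ n] L(3)[of _ m]
        continuous_on_subset[OF L(1)[of m] sub] sub by auto
    \<comment> \<open>The action is free, as it shifts the first coordinate by \<theta>.\<close>
    have "p = act \<theta> p" using bspec[OF \<theta>, of 0] L(2) by simp
    then have "\<theta> = 0" by (simp add: act_def case_prod_unfold prod_eq_iff)
    with \<theta> that(2) show ?thesis by simp
  qed
  define M where "M = (\<lambda>x. L (nat \<lceil>\<bar>x\<bar>\<rceil>) x)"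
  have M: "M x = L n x" if "x \<in> {-real n..real n}" for n x
  proof -
    have "nat \<lceil>\<bar>x\<bar>\<rceil> \<le> n" using that by (simp add: ceiling_le_iff abs_le_iff)
    moreover have "x \<in> {-real (nat \<lceil>\<bar>x\<bar>\<rceil>)..real (nat \<lceil>\<bar>x\<bar>\<rceil>)}"
      using real_nat_ceiling_ge[of "\<bar>x\<bar>"] by (simp only: atLeastAtMost_iff) linarith
    ultimately show ?thesis unfolding M_def by (rule agree)
  qed
  have "isCont M x" for x
  proof -
    \<comment> \<open>The added 1 puts \<open>x\<close> in the interior, where continuity on the
      interval gives continuity at the point.\<close>
    define n where "n = nat \<lceil>\<bar>x\<bar>\<rceil> + 1"
    have x: "x \<in> {-real n<..<real n}"
      unfolding n_def using real_nat_ceiling_ge[of "\<bar>x\<bar>"] by (simp only: greaterThanLessThan_iff) linarith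
    have "continuous_on {-real n<..<real n} M"
      by (rule continuous_on_eq[of _ "L n"]) (auto intro!: M[symmetric] intro: continuous_on_subset[OF L(1)[of n]])
    with x show ?thesis by (simp add: continuous_on_eq_continuous_at)
  qed
  then have "continuous_on UNIV M" by (simp add: continuous_on_eq_continuous_at)
  moreover have "proj (M x) = \<gamma> x" for x
  proof -
    have "x \<in> {-real (nat \<lceil>\<bar>x\<bar>\<rceil>)..real (nat \<lceil>\<bar>x\<bar>\<rceil>)}"
      using real_nat_ceiling_ge[of "\<bar>x\<bar>"] by (simp only: atLeastAtMost_iff) linarith
    then show ?thesis unfolding M_def by (rule L(3))
  qed
  ultimately show ?thesis by (rule that)
qed

section \<open>From a conjugacy to a self-similar cocycle\<close>

text \<open>Only the image of the horizontal line is lifted; the flow then determines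
  \<open>H\<close> on the whole plane, and uniqueness of lifts turns deck invariance into the
  cocycle relation.\<close>

lemma conjugacy_imp_self_similar:
  assumes "s \<noteq> 0" and H: "homeomorphic_map X X H"
    and conj: "\<And>t x. x \<in> topspace X \<Longrightarrow> H (special_flow t x) = special_flow (s * t) (H x)"
  shows "\<exists>\<mu> c g. self_similar \<mu> c s g"
proof -
  have "continuous_map euclideanreal euclidean (\<lambda>x::real. (x, 0::real))"
    by (simp add: continuous_intros)
  then have "continuous_map euclideanreal X (H \<circ> (proj \<circ> (\<lambda>x. (x, 0))))"
    using homeomorphic_imp_continuous_map[OF H] continuous_map_proj
    by (meson continuous_map_compose)
  then obtain L where L: "continuous_on UNIV L" "\<And>x. proj (L x) = H (proj (x, 0))"
    using line_lift by (metis comp_apply)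
  define \<phi> g where "\<phi> = (\<lambda>x. fst (L x))" and "g = (\<lambda>x. snd (L x))"
  have L_eq: "L x = (\<phi> x, g x)" for x
    by (simp add: \<phi>_def g_def)
  have \<phi>_cont: "continuous_on UNIV \<phi>" and g_cont: "continuous_on UNIV g"
    unfolding \<phi>_def g_def by (intro continuous_intros L(1))+
  have Hr: "H (proj (x, r)) = proj (\<phi> x, g x + s * r)" for x r
  proof -
    have "H (proj (x, r)) = H (special_flow r (proj (x, 0)))"
      by (simp add: special_flow_proj)
    also have "\<dots> = special_flow (s * r) (proj (L x))"
      by (subst conj) (auto simp: topspace_X L(2))
    finally show ?thesis by (simp add: L_eq special_flow_proj)
  qed
  have inj: "proj p = proj q" if "H (proj p) = H (proj q)" for p q
    using inj_onD[OF homeomorphic_imp_injective_map[OF H] that] by (auto simp: topspace_X)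
  have equiv: "\<exists>\<theta>'\<in>G. \<forall>x. \<phi> (x + \<theta>) = \<phi> x + \<theta>' \<and> g (x + \<theta>) - s * B \<theta> x = g x - B \<theta>' (\<phi> x)"
    if \<theta>: "\<theta> \<in> G" for \<theta>
  proof -
    \<comment> \<open>A second lift of the same curve, obtained by first moving
      \<open>(x, 0)\<close> by \<open>act \<theta>\<close>.\<close>
    let ?L' = "\<lambda>x. (\<phi> (x + \<theta>), g (x + \<theta>) - s * B \<theta> x)"
    have "continuous_on UNIV ?L'"
      unfolding B_def
      by (intro continuous_intros continuous_on_compose2[OF \<phi>_cont] continuous_on_compose2[OF g_cont]
            continuous_S) auto
    moreover have "proj (L x) = proj (?L' x)" for x
    proof -
      have "proj (?L' x) = H (proj (act \<theta> (x, 0)))"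
        by (simp add: act_def Hr)
      then show ?thesis using \<theta> by (simp add: L(2))
    qed
    ultimately have "\<exists>\<theta>'\<in>G. \<forall>x\<in>UNIV. ?L' x = act \<theta>' (L x)"
      by (rule lift_unique[OF connected_UNIV L(1)])
    then show ?thesis
      by (simp add: act_def L_eq)
  qed
  obtain \<mu> c where \<phi>: "\<And>x. \<phi> x = \<mu> * x + c"
    by (rule equivariant_imp_affine[OF \<phi>_cont]) (meson equiv, blast)
  have into: "\<mu> * \<theta> \<in> G \<and> (\<forall>x. s * B \<theta> x = B (\<mu> * \<theta>) (\<mu> * x + c) + g (x + \<theta>) - g x)"
    if \<theta>: "\<theta> \<in> G" for \<theta>
  proof -
    obtain \<theta>' where \<theta>': "\<theta>' \<in> G" "\<And>x. \<phi> (x + \<theta>) = \<phi> x + \<theta>'"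
        "\<And>x. g (x + \<theta>) - s * B \<theta> x = g x - B \<theta>' (\<phi> x)"
      using equiv[OF \<theta>] by blast
    have "\<theta>' = \<mu> * \<theta>"
      using \<theta>'(2)[of 0] by (simp add: \<phi>)
    with \<theta>'(1,3) show ?thesis by (auto simp: \<phi> algebra_simps)
  qed
  have onto: "\<theta> \<in> G" if "\<mu> * \<theta> \<in> G" for \<theta>
  proof -
    \<comment> \<open>The height at which the image of \<open>(\<theta>, r)\<close> lies in the deck
      orbit of the image of \<open>(0, 0)\<close>; injectivity of \<open>H\<close> then gives
      \<open>\<theta> \<in> G\<close>.\<close>
    define r where "r = (g 0 - B (\<mu> * \<theta>) (\<phi> 0) - g \<theta>) / s"
    have "(\<phi> \<theta>, g \<theta> + s * r) = act (\<mu> * \<theta>) (\<phi> 0, g 0)"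
      using \<open>s \<noteq> 0\<close> by (simp add: act_def r_def \<phi>)
    then have "H (proj (\<theta>, r)) = H (proj (0, 0))"
      using that by (simp add: Hr)
    then have "proj (0, 0) = proj (\<theta>, r)"
      using inj by metis
    then show ?thesis
      by (auto simp: proj_eq_iff act_def)
  qed
  have "\<mu> \<noteq> 0"
  proof
    assume "\<mu> = 0"
    then have "G = UNIV" using onto by auto
    then show False using countable_G uncountable_UNIV_real by simp
  qed
  then have "self_similar \<mu> c s g"
    unfolding self_similar_def using \<open>s \<noteq> 0\<close> g_cont into onto by blast
  then show ?thesis by blast
qed

end

section \<open>Descent of the transfer function to the circle\<close>

theorem theorem8p9:
  fixes \<alpha> :: real and f :: "circle \<Rightarrow> real"
  assumes "\<alpha> \<notin> \<rat>"
    and "continuous_on UNIV f"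
    and "\<And>x. f x > 0"
    and "\<exists>s. s \<in> I_top (special_flow_space \<alpha> f) special_flow - {-1, 1}"
  shows "\<exists>(c::real) (h::circle \<Rightarrow> real). continuous_on UNIV h \<and>
    (\<forall>x. f x - c = h x - h (x + to_circle \<alpha>))"
proof -
  interpret irrational_special_flow \<alpha> f
    by unfold_locales (use assms in auto)
  obtain s where s: "s \<in> I_top X special_flow" "\<bar>s\<bar> \<noteq> 1"
    using assms(4) by (auto simp: abs_if split: if_splits)
  then obtain H where H: "homeomorphic_map X X H"
      "\<And>t x. x \<in> topspace X \<Longrightarrow> H (special_flow t x) = special_flow (s * t) (H x)"
    unfolding I_top_def topologically_conjugate_def by blast
  then obtain \<mu> b g where "self_similar \<mu> b s g"
    using conjugacy_imp_self_similar[OF _ H] s(1) by (auto simp: I_top_def)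
  then obtain c k where k: "continuous_on UNIV k" "\<And>x. k (x + 1) = k x"
      "\<And>x. f (to_circle x) - c = k x - k (x + \<alpha>)"
    using self_similar_imp_coboundary s(2) by metis
  \<comment> \<open>The choice of representative does not matter because \<open>k\<close> is
    1-periodic.\<close>
  define h where "h = (\<lambda>y. k (rep_circle y))"
  have h: "h (to_circle x) = k x" for x
  proof -
    have "rep_circle (to_circle x) - x \<in> \<int>"
      using Quotient_rep_abs[OF Quotient_circle, of x] by simp
    then obtain i where "rep_circle (to_circle x) = x + of_int i"
      by (metis Ints_cases add.commute diff_add_cancel)
    then show ?thesis
      using periodic_add_int[of k, OF k(2)] by (simp add: h_def)
  qed
  have "continuous_on UNIV h"
  proof -
    have "open (k -` U)" if "open U" for U
      using that k(1) by (simp add: continuous_on_open_vimage)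
    then show ?thesis
      by (simp add: continuous_on_open_vimage open_circle_def vimage_def h)
  qed
  moreover have "f y - c = h y - h (y + to_circle \<alpha>)" for y
  proof -
    obtain x where "y = to_circle x" by (rule to_circle_cases)
    then show ?thesis
      using k(3)[of x] by (simp add: h to_circle_add[symmetric])
  qed
  ultimately show ?thesis by blast
qed

end
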